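(* Let $T_{\alpha,\beta}$ be of type infinity, with associated sequence $(k_i)_{i\ge0}$. If for some $\lambda>1$ one has $k_i\ge\lambda k_{i-1}$ for all $i$ sufficiently large, then $T_{\alpha,\beta}$ is not uniquely ergodic.
   Context: Let $U=\{(\alpha,\beta):0\le\beta\le\alpha\le1\}$ with interior $U^\circ$, $L=\{(\alpha,\beta):0\le\alpha\le\beta+1\le1\}$, $R=U\cup L$. For $(\alpha,\beta)\in U^\circ$ define $T_{\alpha,\beta}:[0,1)\to[0,1)$ by $T_{\alpha,\beta}(x)=x+\alpha$ for $x\in[0,1-\alpha)$, $x+\beta$ for $x\in[1-\alpha,1-\beta)$, and $x+\beta-1$ for $x\in[1-\beta,1)$. Put $\Omega_0=[0,1)$, $\Omega_n=T_{\alpha,\beta}(\Omega_{n-1})$, $\Omega=\bigcap_n\Omega_n$; $T_{\alpha,\beta}$ is of type infinity if $\Omega_{n+1}\subsetneq\Omega_n$ for every $n$ (then $\overline\Omega$ is a Cantor set). On $\overline\Omega\setminus\Omega$ the map is (re)defined by continuity from the left. Let $G:U^\circ\to R$, $G(\alpha,\beta)=\big(\frac\beta\alpha,\frac{\beta-1}{\alpha}+\lfloor\frac1\alpha\rfloor\big)$. When $T_{\alpha,\beta}$ is of type infinity all iterates $(\alpha_i,\beta_i)=G^i(\alpha,\beta)$, $i\ge0$, are defined and lie in $U^\circ$, and the associated sequence is $k_i=\lfloor 1/\alpha_i\rfloor$ (i.e. $\frac{1}{k_i+1}<\alpha_i\le\frac1{k_i}$). Uniquely ergodic means having exactly one invariant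 Borel probability measure. *)

theory Defs
  imports "HOL-Probability.Probability"
begin

definition U :: "(real \<times> real) set" where
  "U = {(\<alpha>, \<beta>). 0 \<le> \<beta> \<and> \<beta> \<le> \<alpha> \<and> \<alpha> \<le> 1}"

(* Only the values on [0,1) are meaningful. *)
definition itm :: "real \<Rightarrow> real \<Rightarrow> real \<Rightarrow> real" where
  "itm \<alpha> \<beta> x =
     (if x < 1 - \<alpha> then x + \<alpha>
      else if x < 1 - \<beta> then x + \<beta>
      else x + \<beta> - 1)"

primrec Omega_n :: "real \<Rightarrow> real \<Rightarrow> nat \<Rightarrow> real set" where
  "Omega_n \<alpha> \<beta> 0 = {0..<1}"
| "Omega_n \<alpha> \<beta> (Suc n) = itm \<alpha> \<beta> ` Omega_n \<alpha> \<beta> n"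

definition Omega :: "real \<Rightarrow> real \<Rightarrow> real set" where
  "Omega \<alpha> \<beta> = (\<Inter>n. Omega_n \<alpha> \<beta> n)"

definition type_infinity :: "real \<Rightarrow> real \<Rightarrow> bool" where
  "type_infinity \<alpha> \<beta> \<longleftrightarrow> (\<forall>n. Omega_n \<alpha> \<beta> (Suc n) \<subset> Omega_n \<alpha> \<beta> n)"

(* The map on the closure of Omega.  Each Omega_n is a finite union of intervals [a,b),
   so a point of closure Omega - Omega is a limit of points of Omega from the left only;
   in particular it lies in (0,1], where the left limit exists. *)
definition itm_closure :: "real \<Rightarrow> real \<Rightarrow> real \<Rightarrow> real" where
  "itm_closure \<alpha> \<beta> x =
     (if x \<in> Omega \<alpha> \<beta> then itm \<alpha> \<beta> x else Lim (at_left x) (itm \<alpha> \<beta>))"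

definition G :: "real \<times> real \<Rightarrow> real \<times> real" where
  "G = (\<lambda>(\<alpha>, \<beta>). (\<beta> / \<alpha>, (\<beta> - 1) / \<alpha> + of_int \<lfloor>1 / \<alpha>\<rfloor>))"

definition assoc_seq :: "real \<Rightarrow> real \<Rightarrow> nat \<Rightarrow> int" where
  "assoc_seq \<alpha> \<beta> i = \<lfloor>1 / fst ((G ^^ i) (\<alpha>, \<beta>))\<rfloor>"

definition invariant_borel_prob :: "'a::topological_space set \<Rightarrow> ('a \<Rightarrow> 'a) \<Rightarrow> 'a measure \<Rightarrow> bool" where
  "invariant_borel_prob X f M \<longleftrightarrow>
     sets M = sets (restrict_space borel X) \<and> prob_space M \<and>
     f \<in> measurable M M \<and> distr M M f = M"

definition uniquely_ergodic :: "'a::topological_space set \<Rightarrow> ('a \<Rightarrow> 'a) \<Rightarrow> bool" where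
  "uniquely_ergodic X f \<longleftrightarrow> (\<exists>!M. invariant_borel_prob X f M)"

end

theory Submission
  imports Defs
begin

text \<open>
  The first return map to \<open>[1 - \<alpha>, 1)\<close> is an affine copy of the map with parameters
  \<open>G (\<alpha>, \<beta>)\<close>, with itineraries \<open>1 \<mapsto> 2\<close>, \<open>2 \<mapsto> 3 1^k\<close>, \<open>3 \<mapsto> 3 1^(k-1)\<close>. Hence the Birkhoff sums
  \<open>q\<^sub>n\<close> of a step function along the return path of the middle interval of level \<open>n\<close> satisfy
  \<open>q\<^sub>n\<^sub>+\<^sub>3 = k\<^sub>n\<^sub>+\<^sub>2 q\<^sub>n\<^sub>+\<^sub>1 + q\<^sub>n\<^sub>+\<^sub>2 - q\<^sub>n\<close>, and so do the lengths \<open>h\<^sub>n\<close> of these paths. If the \<open>k\<^sub>n\<close> grow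
  geometrically then \<open>h\<^sub>n / h\<^sub>n\<^sub>+\<^sub>1\<close> is summable, so the even and the odd subsequences decouple: a step
  function with \<open>q / h = 1, -1, 1\<close> on three consecutive late levels keeps an average at least \<open>1/2\<close>
  on all levels of one parity and at most \<open>-1/2\<close> on those of the other. Weak limits
  of the empirical measures along these orbit segments are invariant, because the absence of periodic
  points makes visits to short intervals rare and hence the limits atomless. The two parities give two
  different invariant measures.
\<close>

section \<open>Renormalization\<close>

text \<open>The affine chart from \<open>[0, 1)\<close> onto the inducing interval
  \<open>[1 - \<alpha>, 1)\<close>.\<close>

definition resc :: "real \<Rightarrow> real \<Rightarrow> real" where
  "resc \<alpha> y = 1 - \<alpha> + \<alpha> * y"

text \<open>General step function on the three continuity intervals. Its values are stored as a
  triple so that renormalization acts on them linearly.\<close>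

definition cellval :: "real \<Rightarrow> real \<Rightarrow> real \<times> real \<times> real \<Rightarrow> real \<Rightarrow> real" where
  "cellval \<alpha> \<beta> = (\<lambda>(p, q, r) x. if x < 1 - \<alpha> then p else if x < 1 - \<beta> then q else r)"

text \<open>
  Abelianization of the itineraries: from the sums over one visit to each of the three intervals to
  the sums over the return paths.
\<close>

definition ret_vec :: "real \<Rightarrow> real \<times> real \<times> real \<Rightarrow> real \<times> real \<times> real" where
  "ret_vec k = (\<lambda>(p, q, r). (q, r + k * p, r + (k - 1) * p))"

lemma resc_in: "0 < \<alpha> \<Longrightarrow> \<alpha> < 1 \<Longrightarrow> y \<in> {0..<1} \<Longrightarrow> resc \<alpha> y \<in> {1 - \<alpha>..<1}"
  by (auto simp: resc_def)

lemma resc_unit: "0 < \<alpha> \<Longrightarrow> \<alpha> < 1 \<Longrightarrow> y \<in> {0..<1} \<Longrightarrow> resc \<alpha> y \<in> {0..<1}"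
  using resc_in[of \<alpha> y] by auto

lemma resc_onto:
  assumes "0 < \<alpha>" "x \<in> {1 - \<alpha>..<1}"
  obtains y where "y \<in> {0..<1}" "x = resc \<alpha> y"
proof
  show "x = resc \<alpha> ((x - 1 + \<alpha>) / \<alpha>)" "(x - 1 + \<alpha>) / \<alpha> \<in> {0..<1}"
    using assms by (auto simp: resc_def field_simps)
qed

lemma itm_funpow_add:
  assumes "\<And>i. i < m \<Longrightarrow> x + real i * \<alpha> < 1 - \<alpha>" "n \<le> m"
  shows "(itm \<alpha> \<beta> ^^ n) x = x + real n * \<alpha>"
  using assms(2)
proof (induction n)
  case (Suc n)
  with assms(1)[of n] show ?case by (simp add: itm_def algebra_simps)
qed simp

text \<open>Below \<open>1 - \<alpha>\<close> the map is translation by \<open>\<alpha>\<close>. A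
  step from there cannot jump over \<open>[1 - \<alpha>, 1)\<close>, which has length
  \<open>\<alpha>\<close>.\<close>

lemma itm_hits:
  assumes "0 < \<alpha>" "\<alpha> < 1" "x \<in> {0..<1}"
  shows "\<exists>j\<le>nat \<lfloor>1 / \<alpha>\<rfloor>. (itm \<alpha> \<beta> ^^ j) x \<in> {1 - \<alpha>..<1}"
proof -
  \<comment> \<open>The first time that the translates of \<open>x\<close> reach
    \<open>1 - \<alpha>\<close>; \<open>nat\<close> makes it 0 if \<open>x\<close> is already
    there.\<close>
  define j where "j = nat \<lceil>(1 - \<alpha> - x) / \<alpha>\<rceil>"
  have lt: "x + real i * \<alpha> < 1 - \<alpha>" if "i < j" for i
  proof -
    have "real i < (1 - \<alpha> - x) / \<alpha>"
      using that unfolding j_def by linarith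
    then show ?thesis using assms by (simp add: field_simps)
  qed
  have ge: "1 - \<alpha> \<le> x + real j * \<alpha>"
  proof -
    have "(1 - \<alpha> - x) / \<alpha> \<le> real j"
      unfolding j_def by linarith
    then show ?thesis using assms by (simp add: field_simps)
  qed
  have less: "x + real j * \<alpha> < 1"
  proof (cases j)
    case (Suc i)
    with lt[of i] show ?thesis by (simp add: algebra_simps)
  qed (use assms in simp)
  have "real j \<le> 1 / \<alpha>"
    using less assms by (simp add: field_simps)
  then have "j \<le> nat \<lfloor>1 / \<alpha>\<rfloor>" by linarith
  moreover have "(itm \<alpha> \<beta> ^^ j) x = x + real j * \<alpha>"
    using itm_funpow_add[of j x \<alpha> j] lt by blast
  ultimately show ?thesis using ge less by auto
qed

section \<open>The induced map on \<open>[1 - \<alpha>, 1)\<close>\<close>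

locale itm_interior =
  fixes \<alpha> \<beta> :: real
  assumes beta_pos: "0 < \<beta>" and beta_less: "\<beta> < \<alpha>" and alpha_less: "\<alpha> < 1"
begin

abbreviation "T \<equiv> itm \<alpha> \<beta>"

abbreviation "k \<equiv> nat \<lfloor>1 / \<alpha>\<rfloor>"

abbreviation "\<alpha>' \<equiv> \<beta> / \<alpha>"

abbreviation "\<beta>' \<equiv> (\<beta> - 1) / \<alpha> + of_int \<lfloor>1 / \<alpha>\<rfloor>"

lemma alpha_pos: "0 < \<alpha>"
  using beta_pos beta_less by simp

lemma T_in: "x \<in> {0..<1} \<Longrightarrow> T x \<in> {0..<1}"
  using beta_pos beta_less alpha_less by (auto simp: itm_def)

lemma T_funpow_in: "x \<in> {0..<1} \<Longrightarrow> (T ^^ n) x \<in> {0..<1}"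
  by (induction n) (use T_in in auto)

lemma k_pos: "1 \<le> k"
  using alpha_pos alpha_less by (simp add: le_nat_iff le_floor_iff)

lemma of_int_k: "of_int \<lfloor>1 / \<alpha>\<rfloor> = real k"
  using k_pos by simp

lemma k_bounds: "real k \<le> 1 / \<alpha>" "1 / \<alpha> < real k + 1"
  using alpha_pos unfolding of_int_k[symmetric] by linarith+

text \<open>The second coordinate \<open>\<beta>'\<close> is \<open>\<alpha>'\<close> minus the
  fractional part of \<open>1 / \<alpha>\<close>. It may still be nonpositive or equal to
  \<open>\<alpha>'\<close>; excluding this requires infinite type, see
  \<open>interior_renorm\<close>.\<close>

lemma G_bounds: "0 < \<alpha>'" "\<alpha>' < 1" "\<beta>' \<le> \<alpha>'" "\<alpha>' < \<beta>' + 1"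
proof -
  have *: "of_int \<lfloor>1 / \<alpha>\<rfloor> \<le> 1 / \<alpha>" "1 / \<alpha> < of_int \<lfloor>1 / \<alpha>\<rfloor> + 1"
    by linarith+
  have "\<beta>' = \<alpha>' - 1 / \<alpha> + of_int \<lfloor>1 / \<alpha>\<rfloor>"
    by (simp add: diff_divide_distrib)
  with * show "\<beta>' \<le> \<alpha>'" "\<alpha>' < \<beta>' + 1" by linarith+
  show "0 < \<alpha>'" "\<alpha>' < 1"
    using beta_pos beta_less alpha_pos by auto
qed

lemma G_in:
  assumes "y \<in> {0..<1}"
  shows "itm \<alpha>' \<beta>' y \<in> {0..<1}"
  using assms G_bounds unfolding itm_def by (auto split: if_splits)

text \<open>A point of the middle interval comes back after one step. A point of the third interval
  drops to \<open>[0, \<beta>)\<close> and climbs back by translations by \<open>\<alpha>\<close>.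
  One path serves all \<open>v\<close>, so \<open>v = (1, 1, 1)\<close> measures its length.\<close>

lemma renorm_step:
  assumes y: "y \<in> {0..<1}"
  shows "\<exists>i. 0 < i \<and> i \<le> k + 1 \<and> (T ^^ i) (resc \<alpha> y) = resc \<alpha> (itm \<alpha>' \<beta>' y) \<and>
     (\<forall>v. (\<Sum>j<i. cellval \<alpha> \<beta> v ((T ^^ j) (resc \<alpha> y))) = cellval \<alpha>' \<beta>' (ret_vec k v) y)"
proof (cases "y < 1 - \<alpha>'")
  case True
  have c: "1 - \<alpha> \<le> resc \<alpha> y" "resc \<alpha> y < 1 - \<beta>"
    using y True alpha_pos by (auto simp: resc_def field_simps)
  show ?thesis
    by (rule exI[of _ 1])
      (use c True alpha_pos in \<open>auto simp: cellval_def ret_vec_def itm_def resc_def field_simps\<close>)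
next
  case False
  \<comment> \<open>Number of translations by \<open>\<alpha>\<close> on the way back; it depends on
    whether \<open>y\<close> lies in the second or the third interval of the induced map.\<close>
  define m where "m = (if y < 1 - \<beta>' then k else k - 1)"
  define z where "z = resc \<alpha> y + \<beta> - 1"
  have c: "1 - \<beta> \<le> resc \<alpha> y"
    using y False alpha_pos by (auto simp: resc_def field_simps)
  then have Tz: "T (resc \<alpha> y) = z"
    using beta_less by (simp add: itm_def z_def)
  have ret: "z + real m * \<alpha> = resc \<alpha> (itm \<alpha>' \<beta>' y)"
    using False k_pos alpha_pos
    unfolding itm_def z_def m_def resc_def of_int_k by (auto simp: field_simps of_nat_diff)
  have "z + real m * \<alpha> < 1"
    using ret resc_in[OF alpha_pos alpha_less G_in[OF y]] by simp
  \<comment> \<open>The path ends below 1, so each earlier point, lower by at least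
    \<open>\<alpha>\<close>, is still in the first interval.\<close>
  have cell: "z + real j * \<alpha> < 1 - \<alpha>" if "j < m" for j
  proof -
    have "real j + 1 \<le> real m" using that by simp
    then have "(real j + 1) * \<alpha> \<le> real m * \<alpha>" using alpha_pos by (intro mult_right_mono) auto
    then show ?thesis using \<open>z + real m * \<alpha> < 1\<close> by (simp add: algebra_simps)
  qed
  have orb: "(T ^^ j) z = z + real j * \<alpha>" if "j \<le> m" for j
    using itm_funpow_add[OF cell that] by simp
  show ?thesis
  proof (intro exI[of _ "Suc m"] conjI allI)
    show "Suc m \<le> k + 1" by (simp add: m_def)
    show "(T ^^ Suc m) (resc \<alpha> y) = resc \<alpha> (itm \<alpha>' \<beta>' y)"
      using orb[of m] ret by (simp add: funpow_swap1 Tz)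
    fix v :: "real \<times> real \<times> real"
    obtain p q r where v: "v = (p, q, r)" by (cases v)
    have "(\<Sum>j<Suc m. cellval \<alpha> \<beta> v ((T ^^ j) (resc \<alpha> y)))
        = cellval \<alpha> \<beta> v (resc \<alpha> y) + (\<Sum>j<m. cellval \<alpha> \<beta> v ((T ^^ j) z))"
      by (subst sum.lessThan_Suc_shift) (simp add: funpow_swap1 Tz)
    also have "(\<Sum>j<m. cellval \<alpha> \<beta> v ((T ^^ j) z)) = (\<Sum>j<m. p)"
      by (intro sum.cong refl) (use orb cell in \<open>simp add: v cellval_def\<close>)
    also have "cellval \<alpha> \<beta> v (resc \<alpha> y) = r"
      using c beta_less by (simp add: v cellval_def)
    also have "r + (\<Sum>j<m. p) = cellval \<alpha>' \<beta>' (ret_vec k v) y"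
      using False k_pos by (auto simp: v cellval_def ret_vec_def m_def of_nat_diff algebra_simps)
    finally show "(\<Sum>j<Suc m. cellval \<alpha> \<beta> v ((T ^^ j) (resc \<alpha> y)))
        = cellval \<alpha>' \<beta>' (ret_vec k v) y" .
  qed simp
qed

end

text \<open>
  Unlike \<open>\<not> type_infinity\<close>, this condition visibly passes from the induced map to the full map.
\<close>

definition finite_type :: "real \<Rightarrow> real \<Rightarrow> bool" where
  "finite_type \<alpha> \<beta> \<longleftrightarrow>
     (\<exists>S n. S \<subseteq> {0..<1} \<and> itm \<alpha> \<beta> ` S = S \<and> (\<forall>x\<in>{0..<1}. (itm \<alpha> \<beta> ^^ n) x \<in> S))"

section \<open>Finite type: boundary parameters and passage through renormalization\<close>

lemma Omega_n_eq: "Omega_n \<alpha> \<beta> n = (itm \<alpha> \<beta> ^^ n) ` {0..<1}"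
  by (induction n) (auto simp: image_image)

lemma image_funpow_fixed: "f ` S = S \<Longrightarrow> (f ^^ n) ` S = S"
proof (induction n)
  case (Suc n)
  have "(f ^^ Suc n) ` S = f ` ((f ^^ n) ` S)" by (simp add: image_comp)
  with Suc show ?case by simp
qed simp

text \<open>Invariance gives \<open>S \<subseteq> Omega_n \<alpha> \<beta> n\<close> and absorption
  gives the converse, so the decreasing sequence stops at \<open>n\<close>.\<close>

lemma finite_type_not_infinity:
  assumes "finite_type \<alpha> \<beta>"
  shows "\<not> type_infinity \<alpha> \<beta>"
proof -
  obtain S n where S: "S \<subseteq> {0..<1}" "itm \<alpha> \<beta> ` S = S" "\<forall>x\<in>{0..<1}. (itm \<alpha> \<beta> ^^ n) x \<in> S"
    using assms unfolding finite_type_def by blast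
  have "S \<subseteq> Omega_n \<alpha> \<beta> n"
    using image_mono[OF S(1), of "itm \<alpha> \<beta> ^^ n"] image_funpow_fixed[OF S(2), of n]
    unfolding Omega_n_eq by simp
  then have "Omega_n \<alpha> \<beta> n = S"
    using S(3) unfolding Omega_n_eq by blast
  then have "Omega_n \<alpha> \<beta> (Suc n) = Omega_n \<alpha> \<beta> n"
    using S(2) by simp
  then show ?thesis unfolding type_infinity_def by blast
qed

text \<open>For \<open>\<beta> = \<alpha>\<close> the map is a rotation of \<open>[0, 1)\<close>.
  For \<open>\<beta> \<le> 0\<close> the third interval does not meet \<open>[0, 1)\<close>, and a
  smaller interval is rotated and absorbs everything.\<close>

lemma finite_type_boundary:
  assumes "0 < \<alpha>" "\<alpha> < 1" "\<alpha> < \<beta> + 1" "\<beta> \<le> 0 \<or> \<beta> = \<alpha>"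
  shows "finite_type \<alpha> \<beta>"
proof (cases "\<beta> = \<alpha>")
  case True
  have "x \<in> itm \<alpha> \<beta> ` {0..<1}" if "x \<in> {0..<1}" for x
  proof (cases "x < \<alpha>")
    case True
    then show ?thesis
      by (intro image_eqI[of _ _ "x + 1 - \<alpha>"]) (use that assms \<open>\<beta> = \<alpha>\<close> in \<open>auto simp: itm_def\<close>)
  next
    case False
    then show ?thesis
      by (intro image_eqI[of _ _ "x - \<alpha>"]) (use that assms \<open>\<beta> = \<alpha>\<close> in \<open>auto simp: itm_def\<close>)
  qed
  moreover have "itm \<alpha> \<beta> ` {0..<1} \<subseteq> {0..<1}"
    using assms True by (auto simp: itm_def)
  ultimately have "itm \<alpha> \<beta> ` {0..<1} = {0..<1}" by blast
  then show ?thesis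
    unfolding finite_type_def by (intro exI[of _ "{0..<1}"] exI[of _ 0]) auto
next
  case False
  then have b: "\<beta> \<le> 0" using assms by auto
  \<comment> \<open>On this interval the map exchanges the pieces to the left and right of
    \<open>1 - \<alpha>\<close>. It contains \<open>[1 - \<alpha>, 1)\<close>, which every orbit
    enters.\<close>
  define S where "S = {1 - \<alpha> + \<beta>..<1}"
  have "x \<in> itm \<alpha> \<beta> ` S" if "x \<in> S" for x
  proof (cases "x < 1 + \<beta>")
    case True
    then show ?thesis
      by (intro image_eqI[of _ _ "x - \<beta>"]) (use that assms b in \<open>auto simp: itm_def S_def\<close>)
  next
    case False
    then show ?thesis
      by (intro image_eqI[of _ _ "x - \<alpha>"]) (use that assms b in \<open>auto simp: itm_def S_def\<close>)
  qed
  moreover have inv: "itm \<alpha> \<beta> ` S \<subseteq> S"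
    using assms b by (auto simp: itm_def S_def)
  ultimately have S: "itm \<alpha> \<beta> ` S = S" by blast
  define n where "n = nat \<lfloor>1 / \<alpha>\<rfloor>"
  have "(itm \<alpha> \<beta> ^^ n) x \<in> S" if x: "x \<in> {0..<1}" for x
  proof -
    obtain j where j: "j \<le> n" "(itm \<alpha> \<beta> ^^ j) x \<in> {1 - \<alpha>..<1}"
      using itm_hits[OF assms(1,2) x, of \<beta>] unfolding n_def by blast
    have "(itm \<alpha> \<beta> ^^ n) x = (itm \<alpha> \<beta> ^^ (n - j)) ((itm \<alpha> \<beta> ^^ j) x)"
      using j(1) by (simp flip: comp_apply[of "_ ^^ _"] add: funpow_add[symmetric])
    moreover have "(itm \<alpha> \<beta> ^^ j) x \<in> S"
      using j(2) b by (auto simp: S_def)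
    ultimately show ?thesis
      using image_funpow_fixed[OF S, of "n - j"] by auto
  qed
  moreover have "S \<subseteq> {0..<1}" using assms by (auto simp: S_def)
  ultimately show ?thesis
    unfolding finite_type_def using S by blast
qed

context itm_interior
begin

lemma renorm_iterate:
  assumes "y \<in> {0..<1}"
  shows "\<exists>i. i \<le> n * (k + 1) \<and> (T ^^ i) (resc \<alpha> y) = resc \<alpha> ((itm \<alpha>' \<beta>' ^^ n) y)"
proof (induction n)
  case (Suc n)
  then obtain i where i: "i \<le> n * (k + 1)" "(T ^^ i) (resc \<alpha> y) = resc \<alpha> ((itm \<alpha>' \<beta>' ^^ n) y)"
    by blast
  have "(itm \<alpha>' \<beta>' ^^ n) y \<in> {0..<1}" for n
    by (induction n) (use assms G_in in auto)
  from renorm_step[OF this[of n]] obtain j where j: "j \<le> k + 1"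
    "(T ^^ j) (resc \<alpha> ((itm \<alpha>' \<beta>' ^^ n) y)) = resc \<alpha> ((itm \<alpha>' \<beta>' ^^ Suc n) y)"
    by auto
  show ?case
    by (rule exI[of _ "j + i"]) (use i j in \<open>auto simp: funpow_add\<close>)
qed simp

text \<open>The forward orbits of the embedded copy of \<open>S\<close> form the required invariant
  absorbing set.\<close>

lemma finite_type_renorm:
  assumes "finite_type \<alpha>' \<beta>'"
  shows "finite_type \<alpha> \<beta>"
proof -
  let ?T' = "itm \<alpha>' \<beta>'"
  obtain S n where S: "S \<subseteq> {0..<1}" "?T' ` S = S" "\<forall>x\<in>{0..<1}. (?T' ^^ n) x \<in> S"
    using assms unfolding finite_type_def by blast
  define S' where "S' = (\<Union>j. (T ^^ j) ` resc \<alpha> ` S)"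
  have S'I: "(T ^^ j) (resc \<alpha> y) \<in> S'" if "y \<in> S" for j y
    using that by (auto simp: S'_def)
  have "T ` S' \<subseteq> S'"
  proof
    fix x assume "x \<in> T ` S'"
    then obtain j y where "y \<in> S" "x = (T ^^ Suc j) (resc \<alpha> y)" by (auto simp: S'_def)
    then show "x \<in> S'" using S'I by metis
  qed
  moreover have "S' \<subseteq> T ` S'"
  proof
    fix x assume "x \<in> S'"
    then obtain j y where y: "y \<in> S" "x = (T ^^ j) (resc \<alpha> y)" by (auto simp: S'_def)
    \<comment> \<open>Surjectivity of the induced map on \<open>S\<close> provides a return path
      ending at \<open>resc \<alpha> y\<close>. Since it has positive length, its last step supplies
      a preimage even when \<open>j = 0\<close>.\<close>
    obtain z where z: "z \<in> S" "?T' z = y" using S(2) y by (metis imageE)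
    then obtain i where i: "0 < i" "(T ^^ i) (resc \<alpha> z) = resc \<alpha> y"
      using renorm_step[of z] S(1) by blast
    have "x = (T ^^ (j + i)) (resc \<alpha> z)" using y i by (simp add: funpow_add)
    also have "j + i = Suc (j + (i - 1))" using i by simp
    finally have "x = T ((T ^^ (j + (i - 1))) (resc \<alpha> z))" by simp
    then show "x \<in> T ` S'" using S'I[OF z(1)] by blast
  qed
  ultimately have TS: "T ` S' = S'" by blast
  \<comment> \<open>At most \<open>k\<close> steps to enter \<open>[1 - \<alpha>, 1)\<close>, then
    \<open>n\<close> returns of at most \<open>k + 1\<close> steps each; any steps left over stay in
    \<open>S'\<close>.\<close>
  define m where "m = k + n * (k + 1)"
  have "(T ^^ m) x \<in> S'" if x: "x \<in> {0..<1}" for x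
  proof -
    obtain j where j: "j \<le> k" "(T ^^ j) x \<in> {1 - \<alpha>..<1}"
      using itm_hits[OF alpha_pos alpha_less x, of \<beta>] by blast
    obtain y where y: "y \<in> {0..<1}" "(T ^^ j) x = resc \<alpha> y"
      using resc_onto[OF alpha_pos j(2)] .
    obtain i where i: "i \<le> n * (k + 1)" "(T ^^ i) (resc \<alpha> y) = resc \<alpha> ((?T' ^^ n) y)"
      using renorm_iterate[OF y(1)] by blast
    have "m = (m - (i + j)) + (i + j)" using i j unfolding m_def by linarith
    then have "(T ^^ m) x = (T ^^ (m - (i + j))) ((T ^^ i) ((T ^^ j) x))"
      by (metis comp_apply funpow_add)
    then show ?thesis using i y S(3) S'I by simp
  qed
  moreover have "S' \<subseteq> {0..<1}"
  proof
    fix x assume "x \<in> S'"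
    then obtain j y where "y \<in> S" "x = (T ^^ j) (resc \<alpha> y)" by (auto simp: S'_def)
    then show "x \<in> {0..<1}"
      using T_funpow_in[OF resc_unit[OF alpha_pos alpha_less], of y j] S(1) by blast
  qed
  ultimately show ?thesis
    unfolding finite_type_def using TS by blast
qed

text \<open>Parameters on the boundary would make the induced map, and with it the given one, of
  finite type.\<close>

lemma interior_renorm:
  assumes "\<not> finite_type \<alpha> \<beta>"
  shows "itm_interior \<alpha>' \<beta>'" "\<not> finite_type \<alpha>' \<beta>'"
proof -
  show nf: "\<not> finite_type \<alpha>' \<beta>'" using assms finite_type_renorm by blast
  then show "itm_interior \<alpha>' \<beta>'"
    using G_bounds finite_type_boundary[OF G_bounds(1,2,4)]
    by (intro itm_interior.intro) (metis not_le order_less_le)+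
qed

text \<open>
  The descent behind the absence of periodic points: for \<open>k \<ge> 2\<close> an invariant set inside
  \<open>[1 - \<alpha>, 1)\<close> would lie in the second interval, where the map moves points strictly to the right.
\<close>

lemma card_renorm:
  assumes P: "finite P" "P \<noteq> {}" "P \<subseteq> {0..<1}" "T ` P \<subseteq> P"
  obtains P' where "finite P'" "P' \<noteq> {}" "P' \<subseteq> {0..<1}" "itm \<alpha>' \<beta>' ` P' \<subseteq> P'"
    "2 \<le> k \<Longrightarrow> card P' < card P"
proof
  define P' where "P' = {y \<in> {0..<1}. resc \<alpha> y \<in> P}"
  have inv: "(T ^^ j) x \<in> P" if "x \<in> P" for x j
    by (induction j) (use that P(4) in auto)
  have inj: "inj_on (resc \<alpha>) P'"
    using alpha_pos by (auto simp: inj_on_def resc_def)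
  have sub: "resc \<alpha> ` P' \<subseteq> P" by (auto simp: P'_def)
  show "finite P'" using finite_imageD[OF finite_subset[OF sub P(1)] inj] .
  show "P' \<subseteq> {0..<1}" by (auto simp: P'_def)
  show "itm \<alpha>' \<beta>' ` P' \<subseteq> P'"
  proof safe
    fix y assume "y \<in> P'"
    then have y: "y \<in> {0..<1}" "resc \<alpha> y \<in> P" by (auto simp: P'_def)
    obtain i where "(T ^^ i) (resc \<alpha> y) = resc \<alpha> (itm \<alpha>' \<beta>' y)"
      using renorm_step[OF y(1)] by blast
    then show "itm \<alpha>' \<beta>' y \<in> P'"
      using inv[OF y(2), of i] G_in[OF y(1)] by (simp add: P'_def)
  qed
  show "P' \<noteq> {}"
  proof -
    obtain x where x: "x \<in> P" using P(2) by blast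
    then obtain j where j: "(T ^^ j) x \<in> {1 - \<alpha>..<1}"
      using itm_hits[OF alpha_pos alpha_less, of x \<beta>] P(3) by blast
    obtain y where "y \<in> {0..<1}" "(T ^^ j) x = resc \<alpha> y"
      using resc_onto[OF alpha_pos j] .
    then have "y \<in> P'" using inv[OF x, of j] by (simp add: P'_def)
    then show ?thesis by blast
  qed
  show "card P' < card P" if "2 \<le> k"
  proof (rule ccontr)
    assume "\<not> card P' < card P"
    then have "resc \<alpha> ` P' = P"
      using card_subset_eq[OF P(1) sub] card_mono[OF P(1) sub] card_image[OF inj] by linarith
    moreover have "resc \<alpha> ` P' \<subseteq> {1 - \<alpha>..<1}"
      using resc_in[OF alpha_pos alpha_less] unfolding P'_def by blast
    ultimately have ge: "1 - \<alpha> \<le> x" if "x \<in> P" for x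
      using that by auto
    have "2 \<le> 1 / \<alpha>" using k_bounds(1) that by linarith
    then have half: "\<alpha> \<le> 1 / 2" using alpha_pos by (simp add: field_simps)
    \<comment> \<open>In the second interval the maximum would move further right; in the third it
      would land below \<open>\<beta> < \<alpha> \<le> 1 - \<alpha>\<close>, outside the interval
      that contains \<open>P\<close>.\<close>
    define x where "x = Max P"
    have x: "x \<in> P" "\<And>z. z \<in> P \<Longrightarrow> z \<le> x" using P by (auto simp: x_def)
    have "T x \<in> P" using P(4) x by blast
    moreover have "\<not> x < 1 - \<alpha>" "x < 1" using ge[OF x(1)] x(1) P(3) by auto
    ultimately show False
      using x(2)[of "T x"] ge[of "T x"] beta_pos beta_less half
      by (auto simp: itm_def split: if_splits)
  qed
qed

end

section \<open>Birkhoff sums along return paths\<close>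

text \<open>The term with \<open>K\<close> dominates the recurrence, so the ratios
  \<open>\<rho>\<close> contract by \<open>1 / lam\<close> every second index, up to the error
  \<open>1 / K\<close>, which is summable by geometric growth.\<close>

lemma ratio_summable:
  fixes h K :: "nat \<Rightarrow> real"
  assumes pos: "\<And>n. 0 < h n" and mono: "\<And>n. h n \<le> h (n + 2)"
    and rec: "\<And>n. h (n + 3) = h (n + 2) - h n + K (n + 2) * h (n + 1)"
    and K: "\<And>n. 1 \<le> K n" and lam: "1 < lam"
    and growth: "\<forall>\<^sub>F n in sequentially. lam * K n \<le> K (Suc n)"
  shows "summable (\<lambda>n. h n / h (n + 1))"
proof -
  obtain N where N: "\<And>n. N \<le> n \<Longrightarrow> lam * K n \<le> K (Suc n)"
    using growth unfolding eventually_sequentially by blast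
  have Kpos: "0 < K n" for n using K[of n] by simp
  have sumK: "summable (\<lambda>n. 1 / K n)"
  proof (rule summable_ratio_test[of "1 / lam" N])
    fix n assume "N \<le> n"
    then show "norm (1 / K (Suc n)) \<le> 1 / lam * norm (1 / K n)"
      using N[of n] Kpos[of n] Kpos[of "Suc n"] lam by (simp add: divide_simps mult.commute)
  qed (use lam in simp)
  define \<rho> where "\<rho> n = h n / h (n + 1)" for n
  have \<rho>pos: "0 \<le> \<rho> n" for n using pos by (simp add: \<rho>_def less_imp_le)
  have step: "\<rho> (n + 3) \<le> \<rho> (n + 1) / lam + 1 / K (n + 3)" if "N \<le> n" for n
  proof -
    have up: "h (n + 3) \<le> h (n + 2) + K (n + 2) * h (n + 1)"
      using rec[of n] pos[of n] by simp
    have lo: "K (n + 3) * h (n + 2) \<le> h (n + 4)"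
      using rec[of "n + 1"] mono[of "n + 1"] by (simp add: numeral_eq_Suc)
    have "\<rho> (n + 3) \<le> h (n + 3) / (K (n + 3) * h (n + 2))"
      unfolding \<rho>_def using lo pos Kpos
      by (intro divide_left_mono) (auto simp: less_imp_le numeral_eq_Suc)
    also have "\<dots> \<le> (h (n + 2) + K (n + 2) * h (n + 1)) / (K (n + 3) * h (n + 2))"
      using up pos Kpos by (intro divide_right_mono) (auto simp: less_imp_le)
    also have "\<dots> = 1 / K (n + 3) + K (n + 2) / K (n + 3) * \<rho> (n + 1)"
      using pos[of "n + 2"] Kpos[of "n + 3"] by (simp add: \<rho>_def field_simps)
    also have "K (n + 2) / K (n + 3) * \<rho> (n + 1) \<le> 1 / lam * \<rho> (n + 1)"
    proof (rule mult_right_mono)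
      show "K (n + 2) / K (n + 3) \<le> 1 / lam"
        using N[of "n + 2"] that Kpos[of "n + 3"] lam
        by (simp add: divide_simps numeral_eq_Suc mult.commute)
    qed (rule \<rho>pos)
    finally show ?thesis by simp
  qed
  define \<sigma> where "\<sigma> n = \<rho> (n + N)" for n
  define S where "S = suminf (\<lambda>n. 1 / K n)"
  \<comment> \<open>A partial sum \<open>s\<close> of \<open>\<sigma>\<close> will satisfy
    \<open>s \<le> \<sigma> 0 + \<sigma> 1 + \<sigma> 2 + s / lam + S\<close>; solving for
    \<open>s\<close> gives this bound.\<close>
  define B where "B = (\<sigma> 0 + \<sigma> 1 + \<sigma> 2 + S) / (1 - 1 / lam)"
  have \<sigma>pos: "0 \<le> \<sigma> n" for n by (simp add: \<sigma>_def \<rho>pos)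
  have "(\<Sum>n<m. \<sigma> n) \<le> B" for m
  proof -
    have A: "(\<Sum>n<m + 3. \<sigma> n) = \<sigma> 0 + \<sigma> 1 + \<sigma> 2 + (\<Sum>n<m. \<sigma> (n + 3))"
      by (simp add: sum.lessThan_Suc_shift numeral_eq_Suc del: sum.lessThan_Suc)
    have "(\<Sum>n<m. \<sigma> (n + 3)) \<le> (\<Sum>n<m. \<sigma> (n + 1) / lam + 1 / K (n + N + 3))"
      using step[of "_ + N"] by (intro sum_mono) (simp add: \<sigma>_def algebra_simps)
    also have "\<dots> = (\<Sum>n<m. \<sigma> (n + 1)) / lam + (\<Sum>n<m. 1 / K (n + N + 3))"
      by (simp add: sum.distrib sum_divide_distrib)
    finally have B: "(\<Sum>n<m. \<sigma> (n + 3))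
        \<le> (\<Sum>n<m. \<sigma> (n + 1)) / lam + (\<Sum>n<m. 1 / K (n + N + 3))" .
    have C: "(\<Sum>n<m. \<sigma> (n + 1)) \<le> (\<Sum>n<m + 3. \<sigma> n)"
    proof -
      have "(\<Sum>n<m. \<sigma> (n + 1)) \<le> (\<Sum>n<Suc m. \<sigma> n)"
        using \<sigma>pos[of 0] by (subst sum.lessThan_Suc_shift) simp
      also have "\<dots> \<le> (\<Sum>n<m + 3. \<sigma> n)"
        using \<sigma>pos by (intro sum_mono2) auto
      finally show ?thesis .
    qed
    have D: "(\<Sum>n<m. 1 / K (n + N + 3)) \<le> S"
    proof -
      have "(\<Sum>n<m. 1 / K (n + N + 3)) = sum (\<lambda>n. 1 / K n) ((\<lambda>n. n + N + 3) ` {..<m})"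
        by (subst sum.reindex) (auto simp: inj_on_def)
      also have "\<dots> \<le> S"
        unfolding S_def using sumK Kpos by (intro sum_le_suminf) (auto simp: less_imp_le)
      finally show ?thesis .
    qed
    have "(\<Sum>n<m. \<sigma> (n + 1)) / lam \<le> (\<Sum>n<m + 3. \<sigma> n) / lam"
      using C lam by (intro divide_right_mono) auto
    then have "(\<Sum>n<m + 3. \<sigma> n) - (\<Sum>n<m + 3. \<sigma> n) / lam \<le> \<sigma> 0 + \<sigma> 1 + \<sigma> 2 + S"
      using A B D by linarith
    then have *: "(\<Sum>n<m + 3. \<sigma> n) * (1 - 1 / lam) \<le> \<sigma> 0 + \<sigma> 1 + \<sigma> 2 + S"
      by (simp add: right_diff_distrib)
    have "(\<Sum>n<m. \<sigma> n) \<le> (\<Sum>n<m + 3. \<sigma> n)"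
      using \<sigma>pos by (intro sum_mono2) auto
    also have "\<dots> \<le> B"
      unfolding B_def using * lam by (subst pos_le_divide_eq) auto
    finally show ?thesis .
  qed
  then have "summable \<sigma>"
    by (intro summableI_nonneg_bounded[of _ B] \<sigma>pos)
  then show ?thesis
    unfolding \<sigma>_def \<rho>_def by (subst (asm) summable_iff_shift)
qed

text \<open>Since \<open>q\<close> and \<open>h\<close> obey the same recurrence, dominated by its
  \<open>K\<close> term, \<open>q / h\<close> changes little from \<open>n + 1\<close> to
  \<open>n + 3\<close>. The total drift is at most 6 times the sum of the ratios.\<close>

lemma alternating_ratio:
  fixes h q K :: "nat \<Rightarrow> real"
  assumes pos: "\<And>n. 0 < h n" and mono: "\<And>n. h n \<le> h (n + 2)"
    and rech: "\<And>n. h (n + 3) = h (n + 2) - h n + K (n + 2) * h (n + 1)"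
    and recq: "\<And>n. q (n + 3) = q (n + 2) - q n + K (n + 2) * q (n + 1)"
    and init: "q 0 = h 0" "q 1 = - h 1" "q 2 = h 2"
    and small: "\<And>m. (\<Sum>n<m. h n / h (n + 1)) \<le> 1 / 12"
  shows "\<bar>(-1) ^ n * (q n / h n) - 1\<bar> \<le> 1 / 2"
proof -
  \<comment> \<open>The induction carries the accumulated drift. Indices move by two, and the
    skipped term of the other parity is nonnegative. As \<open>6 / 12 = 1 / 2\<close>, the bound
    implies the estimate \<open>bd\<close> used in the next step.\<close>
  have main: "\<bar>(-1) ^ n * (q n / h n) - 1\<bar> \<le> 6 * (\<Sum>i<n. h i / h (i + 1))" for n
  proof (induction n rule: less_induct)
    case (less n)
    consider "n = 0" | "n = 1" | "n = 2" | m where "n = m + 3"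
    proof (cases "3 \<le> n")
      case True
      then show ?thesis using that(4)[of "n - 3"] by simp
    next
      case False
      then have "n = 0 \<or> n = 1 \<or> n = 2" by linarith
      then show ?thesis using that by blast
    qed
    then show ?case
    proof cases
      case 1
      then show ?thesis using init pos[of 0] by simp
    next
      case 2
      then show ?thesis using init pos[of 0] pos[of 1] by simp
    next
      case 3
      then show ?thesis using init pos[of 0] pos[of 1] pos[of 2] by (simp add: numeral_eq_Suc)
    next
      case 4
      have bd: "\<bar>q j\<bar> \<le> 2 * h j" if "j < n" for j
      proof -
        have "\<bar>(-1) ^ j * (q j / h j) - 1\<bar> \<le> 1 / 2"
          using less[OF that] small[of j] by linarith
        then have "\<bar>(-1) ^ j * (q j / h j)\<bar> \<le> 2" by linarith
        then have "\<bar>q j\<bar> / h j \<le> 2" using pos[of j] by (simp add: abs_mult)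
        then show ?thesis using pos[of j] by (simp add: field_simps)
      qed
      define z where "z j = q j / h j" for j
      have "\<bar>z (m + 1)\<bar> \<le> 2"
        using bd[of "m + 1"] pos[of "m + 1"] 4 by (simp add: z_def field_simps)
      \<comment> \<open>Subtracting \<open>z (m + 1)\<close> times the recurrence of
        \<open>h\<close> from that of \<open>q\<close> cancels the term with
        \<open>K\<close>.\<close>
      have "z (m + 3) - z (m + 1)
          = ((q (m + 2) - q m) - z (m + 1) * (h (m + 2) - h m)) / h (m + 3)"
      proof -
        have "q (m + 1) = z (m + 1) * h (m + 1)" using pos[of "m + 1"] by (simp add: z_def)
        then have "q (m + 3) - z (m + 1) * h (m + 3)
            = (q (m + 2) - q m) - z (m + 1) * (h (m + 2) - h m)"
          by (simp add: rech recq algebra_simps)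
        then show ?thesis using pos[of "m + 3"] by (simp add: z_def[of "m + 3"] field_simps)
      qed
      \<comment> \<open>The constant is 2 + 2 + 2, from \<open>q (m + 2)\<close>, \<open>q m\<close>
        and the product with \<open>z (m + 1)\<close>, each compared with
        \<open>h (m + 2)\<close>.\<close>
      also have "\<bar>\<dots>\<bar> \<le> 6 * h (m + 2) / h (m + 3)"
      proof -
        have "\<bar>z (m + 1) * (h (m + 2) - h m)\<bar> \<le> 2 * h (m + 2)"
          unfolding abs_mult using \<open>\<bar>z (m + 1)\<bar> \<le> 2\<close> mono[of m] pos[of m]
          by (intro mult_mono) auto
        then have "\<bar>(q (m + 2) - q m) - z (m + 1) * (h (m + 2) - h m)\<bar> \<le> 6 * h (m + 2)"
          using bd[of "m + 2"] bd[of m] mono[of m] 4 by auto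
        then show ?thesis
          using pos[of "m + 3"] by (simp add: divide_right_mono)
      qed
      finally have "\<bar>(-1) ^ (m + 3) * z (m + 3) - (-1) ^ (m + 1) * z (m + 1)\<bar>
          \<le> 6 * (h (m + 2) / h (m + 3))"
        by (cases "even m") (auto simp: abs_minus_commute)
      moreover have "\<bar>(-1) ^ (m + 1) * z (m + 1) - 1\<bar> \<le> 6 * (\<Sum>i<m + 1. h i / h (i + 1))"
        using less[of "m + 1"] 4 by (simp add: z_def)
      moreover have "(\<Sum>i<m + 3. h i / h (i + 1))
          = (\<Sum>i<m + 1. h i / h (i + 1)) + h (m + 1) / h (m + 2) + h (m + 2) / h (m + 3)"
        by (simp add: numeral_eq_Suc)
      moreover have "0 \<le> h (m + 1) / h (m + 2)" using pos by (simp add: less_imp_le)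
      ultimately show ?thesis
        using 4 unfolding z_def by auto
    qed
  qed
  show ?thesis using main[of n] small[of n] by linarith
qed

section \<open>The tower of renormalized maps\<close>

locale renorm_seq =
  fixes a b :: "nat \<Rightarrow> real"
  assumes interior: "itm_interior (a n) (b n)"
    and a_Suc: "a (Suc n) = b n / a n"
    and b_Suc: "b (Suc n) = (b n - 1) / a n + of_int \<lfloor>1 / a n\<rfloor>"
begin

definition K :: "nat \<Rightarrow> real" where "K n = real (nat \<lfloor>1 / a n\<rfloor>)"

text \<open>Sums of the level 0 step function \<open>v\<close> along the return paths of the three
  intervals of level \<open>n\<close>.\<close>

primrec vec :: "nat \<Rightarrow> real \<times> real \<times> real \<Rightarrow> real \<times> real \<times> real" where
  "vec 0 v = v"
| "vec (Suc n) v = ret_vec (K n) (vec n v)"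

primrec embed :: "nat \<Rightarrow> real \<Rightarrow> real" where
  "embed 0 y = y"
| "embed (Suc n) y = embed n (resc (a n) y)"

lemma a_bounds: "0 < a n" "a n < 1" "0 < b n" "b n < a n"
  using itm_interior.alpha_pos[OF interior[of n]] itm_interior.alpha_less[OF interior[of n]]
    itm_interior.beta_pos[OF interior[of n]] itm_interior.beta_less[OF interior[of n]] by auto

lemma itm_level_in: "y \<in> {0..<1} \<Longrightarrow> (itm (a n) (b n) ^^ i) y \<in> {0..<1}"
  using itm_interior.T_funpow_in[OF interior] by blast

lemma embed_in: "y \<in> {0..<1} \<Longrightarrow> embed n y \<in> {0..<1}"
  by (induction n arbitrary: y) (use resc_unit a_bounds in auto)

text \<open>A step of level \<open>n + 1\<close> is a chain of steps of level \<open>n\<close>, each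
  of which is a path of level 0 by induction; the sums along concatenated paths add up.\<close>

lemma level_path:
  assumes "y \<in> {0..<1}"
  shows "\<exists>m. (itm (a 0) (b 0) ^^ m) (embed n y) = embed n (itm (a n) (b n) y) \<and>
    (\<forall>v. (\<Sum>j<m. cellval (a 0) (b 0) v ((itm (a 0) (b 0) ^^ j) (embed n y)))
       = cellval (a n) (b n) (vec n v) y)"
  using assms
proof (induction n arbitrary: y)
  case 0
  show ?case by (rule exI[of _ 1]) simp
next
  case (Suc n)
  let ?T = "itm (a 0) (b 0)" and ?Tn = "itm (a n) (b n)"
  have iter: "\<exists>m. (?T ^^ m) (embed n z) = embed n ((?Tn ^^ i) z) \<and>
    (\<forall>v. (\<Sum>j<m. cellval (a 0) (b 0) v ((?T ^^ j) (embed n z)))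
       = (\<Sum>j<i. cellval (a n) (b n) (vec n v) ((?Tn ^^ j) z)))" if z: "z \<in> {0..<1}" for z i
  proof (induction i)
    case 0
    show ?case by (rule exI[of _ 0]) simp
  next
    case (Suc i)
    then obtain m where m: "(?T ^^ m) (embed n z) = embed n ((?Tn ^^ i) z)"
      "\<And>v. (\<Sum>j<m. cellval (a 0) (b 0) v ((?T ^^ j) (embed n z)))
       = (\<Sum>j<i. cellval (a n) (b n) (vec n v) ((?Tn ^^ j) z))" by blast
    obtain l where l: "(?T ^^ l) (embed n ((?Tn ^^ i) z)) = embed n (?Tn ((?Tn ^^ i) z))"
      "\<And>v. (\<Sum>j<l. cellval (a 0) (b 0) v ((?T ^^ j) (embed n ((?Tn ^^ i) z))))
       = cellval (a n) (b n) (vec n v) ((?Tn ^^ i) z)"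
      using Suc.prems \<open>\<And>y. y \<in> {0..<1} \<Longrightarrow> \<exists>m. _ y m\<close>[OF itm_level_in[OF z]] by blast
    show ?case
    proof (intro exI[of _ "m + l"] conjI allI)
      show "(?T ^^ (m + l)) (embed n z) = embed n ((?Tn ^^ Suc i) z)"
        using m(1) l(1) by (simp add: funpow_add add.commute[of m])
      show "(\<Sum>j<m + l. cellval (a 0) (b 0) v ((?T ^^ j) (embed n z)))
       = (\<Sum>j<Suc i. cellval (a n) (b n) (vec n v) ((?Tn ^^ j) z))" for v
      proof -
        have "(\<Sum>j<m + l. cellval (a 0) (b 0) v ((?T ^^ j) (embed n z)))
          = (\<Sum>j<m. cellval (a 0) (b 0) v ((?T ^^ j) (embed n z)))
          + (\<Sum>j<l. cellval (a 0) (b 0) v ((?T ^^ j) ((?T ^^ m) (embed n z))))"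
          by (induction l) (simp_all add: funpow_add add.commute[of m])
        then show ?thesis using m l by simp
      qed
    qed
  qed
  obtain i where i: "(?Tn ^^ i) (resc (a n) y) = resc (a n) (itm (a (Suc n)) (b (Suc n)) y)"
    "\<And>v. (\<Sum>j<i. cellval (a n) (b n) v ((?Tn ^^ j) (resc (a n) y)))
       = cellval (a (Suc n)) (b (Suc n)) (ret_vec (K n) v) y"
    using itm_interior.renorm_step[OF interior[of n] Suc.prems] unfolding a_Suc b_Suc K_def by blast
  have "resc (a n) y \<in> {0..<1}" using resc_unit a_bounds Suc.prems by blast
  from iter[OF this, of i] show ?case unfolding i by simp
qed

definition p :: "real \<times> real \<times> real \<Rightarrow> nat \<Rightarrow> real" where "p v n = fst (vec n v)"
definition q :: "real \<times> real \<times> real \<Rightarrow> nat \<Rightarrow> real" where "q v n = fst (snd (vec n v))"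
definition r :: "real \<times> real \<times> real \<Rightarrow> nat \<Rightarrow> real" where "r v n = snd (snd (vec n v))"

lemma pqr_Suc:
  "p v (Suc n) = q v n" "q v (Suc n) = r v n + K n * p v n"
  "r v (Suc n) = r v n + (K n - 1) * p v n"
  by (simp_all add: p_def q_def r_def ret_vec_def split: prod.split)

text \<open>Eliminate the other two coordinates with \<open>p v (Suc n) = q v n\<close> and
  \<open>r v (Suc n) = q v (Suc n) - p v n\<close>.\<close>

lemma q_rec: "q v (n + 3) = q v (n + 2) - q v n + K (n + 2) * q v (n + 1)"
  by (simp add: pqr_Suc numeral_eq_Suc algebra_simps)

lemma K_ge: "1 \<le> K n"
  unfolding K_def using itm_interior.k_pos[OF interior[of n]] by simp

text \<open>Each \<open>ret_vec\<close> is an invertible linear map, so values prescribed at a late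
  level come from a step function of level 0.\<close>

lemma vec_surj: "\<exists>v. vec n v = w"
proof (induction n arbitrary: w)
  case (Suc n)
  obtain p q r where w: "w = (p, q, r)" by (cases w)
  obtain v where "vec n v = (q - r, p, q - K n * (q - r))" using Suc by blast
  then show ?case unfolding w
    by (intro exI[of _ v]) (simp add: ret_vec_def algebra_simps)
qed simp

lemma q_surj: "\<exists>v. q v N = x0 \<and> q v (Suc N) = x1 \<and> q v (Suc (Suc N)) = x2"
proof -
  \<comment> \<open>Solves \<open>x2 = x1 - p0 + K (Suc N) * x0\<close>, the formula for the third
    value.\<close>
  define p0 where "p0 = x1 - x2 + K (Suc N) * x0"
  obtain v where "vec N v = (p0, x0, x1 - K N * p0)" using vec_surj by blast
  then have "p v N = p0" and "q v N = x0" and "r v N = x1 - K N * p0"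
    by (simp_all add: p_def q_def r_def)
  then have "q v (Suc N) = x1" "q v (Suc (Suc N)) = x1 - p0 + K (Suc N) * x0"
    by (simp_all add: pqr_Suc algebra_simps)
  then show ?thesis
    using \<open>q v N = x0\<close> by (intro exI[of _ v]) (simp add: p0_def)
qed

text \<open>Sums of the constant 1, that is, lengths of the middle return paths.\<close>

abbreviation "h \<equiv> q (1, 1, 1)"

lemma lengths_ge: "1 \<le> p (1, 1, 1) n \<and> 1 \<le> h n \<and> 1 \<le> r (1, 1, 1) n"
proof (induction n)
  case (Suc n)
  have "1 \<le> K n * p (1, 1, 1) n"
    using Suc K_ge[of n] by (metis mult_mono' mult_1 zero_le_one)
  moreover have "0 \<le> (K n - 1) * p (1, 1, 1) n"
    using Suc K_ge[of n] by simp
  ultimately show ?case using Suc by (simp add: pqr_Suc)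
qed (simp add: p_def q_def r_def)

text \<open>The difference is the length of the third return path at level
  \<open>n + 2\<close>.\<close>

lemma h_Suc_Suc: "h n + 1 \<le> h (n + 2)"
  using lengths_ge[of "Suc (Suc n)"] by (simp add: pqr_Suc algebra_simps numeral_eq_Suc)

lemma h_ge: "real n / 2 \<le> h n"
proof (induction n rule: nat_less_induct)
  case (1 n)
  consider "n = 0" | "n = 1" | m where "n = m + 2"
  proof (cases "2 \<le> n")
    case True
    then show ?thesis using that(3)[of "n - 2"] by simp
  next
    case False
    then have "n = 0 \<or> n = 1" by linarith
    then show ?thesis using that by blast
  qed
  then show ?case
  proof cases
    case 3
    then show ?thesis using 1[rule_format, of m] h_Suc_Suc[of m] by simp
  qed (use lengths_ge[of 0] lengths_ge[of 1] in auto)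
qed

lemma orbit_segment:
  "\<exists>x m. x \<in> {0..<1} \<and> real m = h n \<and>
     (\<forall>v. (\<Sum>j<m. cellval (a 0) (b 0) v ((itm (a 0) (b 0) ^^ j) x)) = q v n)"
proof -
  \<comment> \<open>Left endpoint of the middle interval of level \<open>n\<close>; its return path
    is the segment.\<close>
  define y where "y = 1 - a n"
  have y: "y \<in> {0..<1}" using a_bounds[of n] by (simp add: y_def)
  obtain m where m: "\<And>v. (\<Sum>j<m. cellval (a 0) (b 0) v ((itm (a 0) (b 0) ^^ j) (embed n y)))
       = cellval (a n) (b n) (vec n v) y"
    using level_path[OF y] by blast
  have c: "cellval (a n) (b n) (vec n v) y = q v n" for v
    using a_bounds[of n] by (simp add: y_def cellval_def q_def split: prod.split)
  have "cellval (a 0) (b 0) (1, 1, 1) z = 1" for z by (simp add: cellval_def)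
  then have "real m = h n" using m[of "(1, 1, 1)"] c by simp
  then show ?thesis using embed_in[OF y, of n] m c by auto
qed

text \<open>A single step function separates the two parities: its averages are at least 1/2 on even
  segments and at most -1/2 on odd ones.\<close>

lemma oscillating_averages:
  assumes lam: "1 < lam" and growth: "\<forall>\<^sub>F n in sequentially. lam * K n \<le> K (Suc n)"
  shows "\<exists>v x m. (\<forall>i. x i \<in> {0..<1} \<and> real i / 2 \<le> real (m i) \<and> 0 < m i) \<and>
    (\<forall>i. 1 / 2 \<le> (-1) ^ i * ((\<Sum>j<m i. cellval (a 0) (b 0) v ((itm (a 0) (b 0) ^^ j) (x i))) / m i))"
proof -
  have hpos: "0 < h n" for n using lengths_ge[of n] by simp
  have hmono: "h n \<le> h (n + 2)" for n using h_Suc_Suc[of n] by simp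
  have sum: "summable (\<lambda>n. h n / h (n + 1))"
    by (rule ratio_summable[OF hpos hmono q_rec K_ge lam growth])
  \<comment> \<open>Starting this late makes the total drift small enough for
    \<open>alternating_ratio\<close>; segment \<open>i\<close> then belongs to level
    \<open>i + N\<close>.\<close>
  obtain N where N: "norm (\<Sum>i. h (i + N) / h (i + N + 1)) < 1 / 12"
    using suminf_exist_split[OF _ sum, of "1 / 12"] by auto
  obtain v where v: "q v N = h N" "q v (Suc N) = - h (Suc N)" "q v (Suc (Suc N)) = h (Suc (Suc N))"
    using q_surj by blast
  have small: "(\<Sum>i<m. h (i + N) / h (i + 1 + N)) \<le> 1 / 12" for m
  proof -
    have "(\<Sum>i<m. h (i + N) / h (i + N + 1)) \<le> (\<Sum>i. h (i + N) / h (i + N + 1))"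
      using summable_ignore_initial_segment[OF sum, of N] hpos
      by (intro sum_le_suminf) (auto simp: less_imp_le)
    then show ?thesis using N by (simp add: add.commute add.left_commute)
  qed
  have alt: "\<bar>(-1) ^ i * (q v (i + N) / h (i + N)) - 1\<bar> \<le> 1 / 2" for i
    by (rule alternating_ratio[of "\<lambda>i. h (i + N)" "\<lambda>i. K (i + N)" "\<lambda>i. q v (i + N)"])
      (use hpos hmono[of "_ + N"] q_rec[of _ "_ + N"] v small in \<open>simp_all add: ac_simps numeral_eq_Suc\<close>)
  have "\<forall>i. \<exists>x m. x \<in> {0..<1} \<and> real m = h (i + N) \<and>
     (\<forall>v. (\<Sum>j<m. cellval (a 0) (b 0) v ((itm (a 0) (b 0) ^^ j) x)) = q v (i + N))"
    using orbit_segment by blast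
  then obtain x m where xm: "\<And>i. x i \<in> {0..<1}" "\<And>i. real (m i) = h (i + N)"
     "\<And>i v. (\<Sum>j<m i. cellval (a 0) (b 0) v ((itm (a 0) (b 0) ^^ j) (x i))) = q v (i + N)"
    by metis
  have "real i / 2 \<le> real (m i)" for i
    using h_ge[of "i + N"] xm(2)[of i] by simp
  moreover have "0 < m i" for i
    using xm(2)[of i] hpos[of "i + N"] by (cases "m i") auto
  moreover have "1 / 2 \<le> (-1) ^ i * (q v (i + N) / real (m i))" for i
    using alt[of i] unfolding xm(2) by linarith
  ultimately show ?thesis
    using xm by (intro exI[of _ v] exI[of _ x] exI[of _ m]) simp
qed

lemma K_eventually_ge_2:
  assumes lam: "1 < lam" and growth: "\<forall>\<^sub>F n in sequentially. lam * K n \<le> K (Suc n)"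
  shows "\<exists>N. \<forall>n\<ge>N. 2 \<le> K n"
proof -
  obtain N where N: "\<And>n. N \<le> n \<Longrightarrow> lam * K n \<le> K (Suc n)"
    using growth unfolding eventually_sequentially by blast
  have "lam ^ i \<le> K (N + i)" for i
  proof (induction i)
    case (Suc i)
    have "lam ^ Suc i \<le> lam * K (N + i)" using Suc lam by simp
    with N[of "N + i"] show ?case by simp
  qed (simp add: K_ge)
  moreover obtain i where "2 < lam ^ i" using real_arch_pow[OF lam] by blast
  ultimately have "2 \<le> K (N + j)" if "i \<le> j" for j
    using that power_increasing[OF that, of lam] lam by (smt (verit))
  then show ?thesis
    by (intro exI[of _ "N + i"]) (auto simp: le_iff_add[of "N + i"] add.assoc)
qed

text \<open>Infinite descent: a nonempty forward invariant finite set survives to every level, while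
  its cardinality drops strictly from level \<open>N\<close> on.\<close>

lemma aperiodic:
  assumes N: "\<And>n. N \<le> n \<Longrightarrow> 2 \<le> K n"
    and P: "finite P" "P \<subseteq> {0..<1}" "itm (a 0) (b 0) ` P \<subseteq> P"
  shows "P = {}"
proof (rule ccontr)
  define fwd where "fwd n Q \<longleftrightarrow> finite Q \<and> Q \<noteq> {} \<and> Q \<subseteq> {0..<1} \<and> itm (a n) (b n) ` Q \<subseteq> Q"
    for n and Q :: "real set"
  have step: "\<exists>Q'. fwd (Suc n) Q' \<and> (2 \<le> K n \<longrightarrow> card Q' < card Q)" if "fwd n Q" for n Q
    using itm_interior.card_renorm[OF interior[of n], of Q] that
    unfolding fwd_def a_Suc b_Suc K_def by (metis of_nat_le_iff of_nat_numeral)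
  have no: "\<not> fwd n Q" if "N \<le> n" for n Q
    using that
  proof (induction "card Q" arbitrary: n Q rule: less_induct)
    case less
    show ?case using step[of n Q] less N[of n] by (meson le_SucI)
  qed
  assume "P \<noteq> {}"
  then have "fwd 0 P" using P by (simp add: fwd_def)
  then have "\<exists>Q. fwd n Q" for n
    by (induction n) (use step in blast)+
  then show False using no[of N] by blast
qed

end

section \<open>Limits of empirical measures\<close>

lemma finite_frontier_Un: "finite (frontier A) \<Longrightarrow> finite (frontier B) \<Longrightarrow> finite (frontier (A \<union> B))"
  by (meson finite_UnI finite_subset frontier_Un_subset)

lemma finite_frontier_Int: "finite (frontier A) \<Longrightarrow> finite (frontier B) \<Longrightarrow> finite (frontier (A \<inter> B))"
  by (meson finite_UnI finite_subset frontier_Int_subset)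

lemma finite_frontier_atLeastLessThan: "finite (frontier {a..<b::real})"
  unfolding atLeastLessThan_def by (intro finite_frontier_Int) auto

text \<open>Such a set is its open interior plus finitely many points. Finite frontiers survive
  images and preimages under the map and are null for atomless measures.\<close>

lemma finite_frontier_borel:
  fixes A :: "real set"
  assumes "finite (frontier A)"
  shows "A \<in> sets borel"
proof -
  have "A = interior A \<union> (A \<inter> frontier A)"
    using interior_subset[of A] closure_subset[of A] by (auto simp: frontier_def)
  moreover have "A \<inter> frontier A \<in> sets borel"
    using assms by (intro borel_closed finite_imp_closed) auto
  moreover have "interior A \<in> sets borel" by auto
  ultimately show ?thesis by (metis sets.Un)
qed

text \<open>
  This property of the \<open>\<Omega>\<^sub>n\<close> forces points of \<open>closure \<Omega> - \<Omega>\<close> to be limits from the left.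
\<close>

definition right_open_compl :: "real set \<Rightarrow> bool" where
  "right_open_compl A \<longleftrightarrow> (\<forall>x. x \<notin> A \<longrightarrow> (\<exists>e>0. {x..<x + e} \<inter> A = {}))"

lemma right_open_compl_Un:
  assumes "right_open_compl A" "right_open_compl B"
  shows "right_open_compl (A \<union> B)"
  unfolding right_open_compl_def
proof (intro allI impI)
  fix x assume "x \<notin> A \<union> B"
  then obtain e e' where "0 < e" "{x..<x + e} \<inter> A = {}" "0 < e'" "{x..<x + e'} \<inter> B = {}"
    using assms unfolding right_open_compl_def by blast
  then show "\<exists>e>0. {x..<x + e} \<inter> (A \<union> B) = {}"
    by (intro exI[of _ "min e e'"]) fastforce
qed

lemma right_open_compl_Int: "right_open_compl A \<Longrightarrow> right_open_compl B \<Longrightarrow> right_open_compl (A \<inter> B)"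
  unfolding right_open_compl_def by blast

lemma right_open_compl_lessThan: "right_open_compl {..<a}"
  unfolding right_open_compl_def by (auto intro!: exI[of _ 1])

lemma right_open_compl_atLeast: "right_open_compl {a..}"
  unfolding right_open_compl_def
proof (intro allI impI)
  fix x assume "x \<notin> {a..}"
  then show "\<exists>e>0. {x..<x + e} \<inter> {a..} = {}"
    by (intro exI[of _ "a - x"]) auto
qed

lemma right_open_compl_atLeastLessThan: "right_open_compl {a..<b}"
  unfolding atLeastLessThan_def
  by (intro right_open_compl_Int right_open_compl_lessThan right_open_compl_atLeast)

lemma right_open_compl_translation:
  assumes "right_open_compl A"
  shows "right_open_compl ((+) c ` A)"
  unfolding right_open_compl_def
proof (intro allI impI)
  fix x assume "x \<notin> (+) c ` A"
  then have "x - c \<notin> A" by (metis add.commute diff_add_cancel image_eqI)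
  then obtain e where e: "0 < e" "{x - c..<x - c + e} \<inter> A = {}"
    using assms unfolding right_open_compl_def by blast
  have "y \<notin> (+) c ` A" if "y \<in> {x..<x + e}" for y
  proof
    assume "y \<in> (+) c ` A"
    then obtain z where "z \<in> A" "y = c + z" by blast
    moreover from this that have "z \<in> {x - c..<x - c + e}" by auto
    ultimately show False using e(2) by blast
  qed
  with e(1) show "\<exists>e>0. {x..<x + e} \<inter> (+) c ` A = {}" by blast
qed

lemma finite_frontier_translation:
  fixes A :: "real set"
  shows "finite (frontier A) \<Longrightarrow> finite (frontier ((+) c ` A))"
  by (simp only: frontier_translation finite_imageI)

text \<open>Division by \<open>d\<close> is injective on \<open>A\<close>.\<close>

lemma card_separated:
  fixes A :: "nat set"
  assumes "A \<subseteq> {..<n}" "\<And>i j. i \<in> A \<Longrightarrow> j \<in> A \<Longrightarrow> i < j \<Longrightarrow> d \<le> j - i" "0 < d"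
  shows "card A \<le> n div d + 1"
proof -
  have inj: "inj_on (\<lambda>i. i div d) A"
  proof (rule linorder_inj_onI)
    fix i j assume "i < j" "i \<in> A" "j \<in> A"
    then have "i + d \<le> j" using assms(2)[of i j] by linarith
    then have "(i + d) div d \<le> j div d" by (rule div_le_mono)
    then show "i div d \<noteq> j div d" using assms(3) by simp
  qed auto
  have "(\<lambda>i. i div d) ` A \<subseteq> {..n div d}"
    using assms(1) by (auto intro!: div_le_mono)
  then have "card ((\<lambda>i. i div d) ` A) \<le> card {..n div d}"
    by (intro card_mono) auto
  then show ?thesis using card_image[OF inj] by simp
qed

context itm_interior
begin

text \<open>Reduces images to intersections, translations and unions, under which both regularity
  properties of sets are stable.\<close>

lemma itm_image:
  "T ` A = (+) \<alpha> ` (A \<inter> {..<1 - \<alpha>}) \<union> (+) \<beta> ` (A \<inter> {1 - \<alpha>..<1 - \<beta>}) \<union> (+) (\<beta> - 1) ` (A \<inter> {1 - \<beta>..})"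
proof -
  have "A = (A \<inter> {..<1 - \<alpha>}) \<union> (A \<inter> {1 - \<alpha>..<1 - \<beta>}) \<union> (A \<inter> {1 - \<beta>..})"
    using beta_less by auto
  then have "T ` A = T ` (A \<inter> {..<1 - \<alpha>}) \<union> T ` (A \<inter> {1 - \<alpha>..<1 - \<beta>}) \<union> T ` (A \<inter> {1 - \<beta>..})"
    by (metis image_Un)
  moreover have "T ` (A \<inter> {..<1 - \<alpha>}) = (+) \<alpha> ` (A \<inter> {..<1 - \<alpha>})"
    by (rule image_cong) (auto simp: itm_def)
  moreover have "T ` (A \<inter> {1 - \<alpha>..<1 - \<beta>}) = (+) \<beta> ` (A \<inter> {1 - \<alpha>..<1 - \<beta>})"
    by (rule image_cong) (auto simp: itm_def)
  moreover have "T ` (A \<inter> {1 - \<beta>..}) = (+) (\<beta> - 1) ` (A \<inter> {1 - \<beta>..})"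
    using beta_less by (intro image_cong) (auto simp: itm_def)
  ultimately show ?thesis by simp
qed

lemma itm_vimage:
  "T -` A = ({..<1 - \<alpha>} \<inter> (+) (- \<alpha>) ` A) \<union> ({1 - \<alpha>..<1 - \<beta>} \<inter> (+) (- \<beta>) ` A)
     \<union> ({1 - \<beta>..} \<inter> (+) (1 - \<beta>) ` A)"
proof -
  have *: "y \<in> (+) c ` A \<longleftrightarrow> y - c \<in> A" for c y :: real
    by (auto intro: image_eqI[of _ _ "y - c"])
  show ?thesis
    unfolding set_eq_iff Un_iff Int_iff * vimage_eq
    using beta_less by (auto simp: itm_def algebra_simps)
qed

lemma finite_frontier_vimage: "finite (frontier A) \<Longrightarrow> finite (frontier (T -` A))"
  unfolding itm_vimage
  by (intro finite_frontier_Un finite_frontier_Int finite_frontier_atLeastLessThan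
      finite_frontier_translation) simp_all

lemma Omega_n_regular:
  "finite (frontier (Omega_n \<alpha> \<beta> n)) \<and> right_open_compl (Omega_n \<alpha> \<beta> n)"
proof (induction n)
  case 0
  show ?case using finite_frontier_atLeastLessThan right_open_compl_atLeastLessThan by simp
next
  case (Suc n)
  then have "finite (frontier (T ` Omega_n \<alpha> \<beta> n))"
    unfolding itm_image
    by (intro finite_frontier_Un finite_frontier_translation finite_frontier_Int
        finite_frontier_atLeastLessThan) simp_all
  moreover have "right_open_compl (T ` Omega_n \<alpha> \<beta> n)"
    using Suc unfolding itm_image
    by (intro right_open_compl_Un right_open_compl_translation right_open_compl_Int
        right_open_compl_atLeastLessThan right_open_compl_lessThan right_open_compl_atLeast) auto
  ultimately show ?case by simp
qed

lemma Omega_n_mono: "m \<le> n \<Longrightarrow> Omega_n \<alpha> \<beta> n \<subseteq> Omega_n \<alpha> \<beta> m"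
proof (rule lift_Suc_antimono_le[of "Omega_n \<alpha> \<beta>"])
  show "Omega_n \<alpha> \<beta> (Suc n) \<subseteq> Omega_n \<alpha> \<beta> n" for n
    by (induction n) (use T_in in auto)
qed

lemma Omega_borel: "Omega \<alpha> \<beta> \<in> sets borel"
  unfolding Omega_def using Omega_n_regular finite_frontier_borel by (intro sets.countable_INT) auto

lemma itm_Omega: "x \<in> Omega \<alpha> \<beta> \<Longrightarrow> T x \<in> Omega \<alpha> \<beta>"
proof -
  assume x: "x \<in> Omega \<alpha> \<beta>"
  have "T x \<in> Omega_n \<alpha> \<beta> (Suc n)" for n
    using x unfolding Omega_def by simp
  then have "T x \<in> Omega_n \<alpha> \<beta> n" for n
    using Omega_n_mono[of n "Suc n"] by auto
  then show ?thesis by (simp add: Omega_def)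
qed

definition itm_left :: "real \<Rightarrow> real" where
  "itm_left x = (if x \<le> 1 - \<alpha> then x + \<alpha> else if x \<le> 1 - \<beta> then x + \<beta> else x + \<beta> - 1)"

lemma itm_left_limit: "(T \<longlongrightarrow> itm_left x) (at_left x)"
proof -
  \<comment> \<open>The translation in force immediately to the left of \<open>x\<close>, valid on
    the interval from \<open>y\<close> below up to \<open>x\<close>.\<close>
  define c where "c = (if x \<le> 1 - \<alpha> then \<alpha> else if x \<le> 1 - \<beta> then \<beta> else \<beta> - 1)"
  define y where "y = (if x \<le> 1 - \<alpha> then x - 1 else if x \<le> 1 - \<beta> then 1 - \<alpha> else 1 - \<beta>)"
  have "\<forall>\<^sub>F z in at_left x. z + c = T z"
    by (rule eventually_at_leftI[of y]) (use beta_less in \<open>auto simp: itm_def c_def y_def\<close>)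
  moreover have "((\<lambda>z. z + c) \<longlongrightarrow> itm_left x) (at_left x)"
    unfolding itm_left_def c_def by (auto intro!: tendsto_eq_intros)
  ultimately show ?thesis by (rule Lim_transform_eventually[rotated])
qed

lemma itm_closure_eq: "itm_closure \<alpha> \<beta> x = (if x \<in> Omega \<alpha> \<beta> then T x else itm_left x)"
  unfolding itm_closure_def using tendsto_Lim[OF _ itm_left_limit[of x]] by simp

lemma itm_measurable [measurable]: "T \<in> borel_measurable borel"
  unfolding itm_def[abs_def] by measurable

lemma itm_closure_measurable: "itm_closure \<alpha> \<beta> \<in> borel_measurable borel"
proof -
  note [measurable] = Omega_borel
  have "itm_left \<in> borel_measurable borel"
    unfolding itm_left_def[abs_def] by measurable
  then show ?thesis
    unfolding itm_closure_eq[abs_def] by measurable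
qed

text \<open>At a point of the closure outside \<open>Omega \<alpha> \<beta>\<close>, the set
  accumulates only from the left, so the left limit of the map is a limit of points of the
  set.\<close>

lemma itm_closure_in:
  assumes "x \<in> closure (Omega \<alpha> \<beta>)"
  shows "itm_closure \<alpha> \<beta> x \<in> closure (Omega \<alpha> \<beta>)"
proof (cases "x \<in> Omega \<alpha> \<beta>")
  case True
  then show ?thesis
    using itm_Omega closure_subset[of "Omega \<alpha> \<beta>"] by (auto simp: itm_closure_eq)
next
  case False
  then obtain n where "x \<notin> Omega_n \<alpha> \<beta> n" by (auto simp: Omega_def)
  then obtain e where e: "0 < e" "{x..<x + e} \<inter> Omega_n \<alpha> \<beta> n = {}"
    using Omega_n_regular unfolding right_open_compl_def by blast
  have disj: "{x..<x + e} \<inter> Omega \<alpha> \<beta> = {}" using e(2) by (auto simp: Omega_def)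
  have "at x within Omega \<alpha> \<beta> = at x within (Omega \<alpha> \<beta> \<inter> {..<x})"
    by (rule at_within_nhd[of _ "{..<x + e}"]) (use e(1) disj in \<open>auto simp: disjoint_iff not_less\<close>)
  also have "\<dots> \<le> at_left x" by (rule at_le) auto
  finally have "(T \<longlongrightarrow> itm_left x) (at x within Omega \<alpha> \<beta>)"
    using itm_left_limit tendsto_mono by blast
  moreover have "\<forall>\<^sub>F y in at x within Omega \<alpha> \<beta>. T y \<in> closure (Omega \<alpha> \<beta>)"
    unfolding eventually_at_filter
    using itm_Omega closure_subset[of "Omega \<alpha> \<beta>"] by (intro always_eventually) auto
  moreover have "at x within Omega \<alpha> \<beta> \<noteq> bot"
    using assms False by (simp add: trivial_limit_within closure_def)
  ultimately have "itm_left x \<in> closure (Omega \<alpha> \<beta>)"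
    using Lim_in_closed_set[OF closed_closure] by blast
  then show ?thesis using False by (simp add: itm_closure_eq)
qed

end

section \<open>Rarity of visits to short intervals\<close>

locale itm_aperiodic = itm_interior +
  assumes aperiodic: "\<And>P. finite P \<Longrightarrow> P \<subseteq> {0..<1} \<Longrightarrow> itm \<alpha> \<beta> ` P \<subseteq> P \<Longrightarrow> P = {}"
begin

lemma no_periodic_point:
  assumes "x \<in> {0..<1}" "0 < j"
  shows "(T ^^ j) x \<noteq> x"
proof
  assume per: "(T ^^ j) x = x"
  define P where "P = (\<lambda>i. (T ^^ i) x) ` {..<j}"
  have "T ` P \<subseteq> P"
  proof
    fix y assume "y \<in> T ` P"
    then obtain i where i: "i < j" "y = (T ^^ Suc i) x" by (auto simp: P_def)
    show "y \<in> P"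
    proof (cases "Suc i = j")
      case True
      then have "y = (T ^^ 0) x" using i per by (simp del: funpow.simps(2))
      then show ?thesis using assms(2) unfolding P_def by blast
    next
      case False
      then show ?thesis using i unfolding P_def by (intro image_eqI[of _ _ "Suc i"]) auto
    qed
  qed
  moreover have "P \<subseteq> {0..<1}" using T_funpow_in[OF assms(1)] by (auto simp: P_def)
  ultimately have "P = {}" using aperiodic[of P] by (simp add: P_def)
  then show False using assms(2) by (auto simp: P_def)
qed

text \<open>Each displacement is a sum of \<open>j\<close> numbers from
  \<open>{\<alpha>, \<beta>, \<beta> - 1}\<close>.\<close>

lemma finite_displacements: "finite {(T ^^ j) x - x |x. x \<in> {0..<1}}"
proof (induction j)
  case 0
  have "{(T ^^ 0) x - x |x. x \<in> {0..<1}} \<subseteq> {0}" by auto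
  then show ?case using finite_subset by blast
next
  case (Suc j)
  have "{(T ^^ Suc j) x - x |x. x \<in> {0..<1}}
      \<subseteq> (\<lambda>(d, e). d + e) ` ({(T ^^ j) x - x |x. x \<in> {0..<1}} \<times> {\<alpha>, \<beta>, \<beta> - 1})"
  proof
    fix d assume "d \<in> {(T ^^ Suc j) x - x |x. x \<in> {0..<1}}"
    then obtain x where x: "x \<in> {0..<1}" "d = T ((T ^^ j) x) - x" by auto
    then have "d = ((T ^^ j) x - x) + (T ((T ^^ j) x) - (T ^^ j) x)" by simp
    moreover have "T ((T ^^ j) x) - (T ^^ j) x \<in> {\<alpha>, \<beta>, \<beta> - 1}" by (simp add: itm_def)
    ultimately show "d \<in> (\<lambda>(d, e). d + e) ` ({(T ^^ j) x - x |x. x \<in> {0..<1}} \<times> {\<alpha>, \<beta>, \<beta> - 1})"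
      using x(1) by (intro image_eqI[of _ _ "((T ^^ j) x - x, T ((T ^^ j) x) - (T ^^ j) x)"]) auto
  qed
  then show ?case using Suc finite_subset by blast
qed

lemma return_gap:
  "\<exists>\<delta>>0. \<forall>x\<in>{0..<1}. \<forall>j. 0 < j \<and> j \<le> n \<longrightarrow> \<delta> \<le> \<bar>(T ^^ j) x - x\<bar>"
proof -
  define D where "D = (\<Union>j\<in>{1..n}. {(T ^^ j) x - x |x. x \<in> {0..<1}})"
  have fin: "finite D" unfolding D_def using finite_displacements by blast
  have nz: "d \<noteq> 0" if "d \<in> D" for d
    using that no_periodic_point unfolding D_def by fastforce
  \<comment> \<open>Inserting 1 keeps the minimum meaningful when \<open>n = 0\<close> and
    \<open>D\<close> is empty.\<close>
  define \<delta> where "\<delta> = Min (insert 1 (abs ` D))"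
  have "0 < \<delta>" unfolding \<delta>_def using fin nz by (subst Min_gr_iff) auto
  moreover have "\<delta> \<le> \<bar>(T ^^ j) x - x\<bar>" if "x \<in> {0..<1}" "0 < j" "j \<le> n" for x j
  proof -
    have "(T ^^ j) x - x \<in> D" unfolding D_def using that by auto
    then show ?thesis unfolding \<delta>_def using fin by (intro Min_le) auto
  qed
  ultimately show ?thesis by blast
qed

text \<open>By \<open>return_gap\<close>, two visits to a set of such small diameter are more than
  \<open>n\<close> steps apart.\<close>

lemma sparse_visits:
  "\<exists>\<delta>>0. \<forall>x\<in>{0..<1}. \<forall>J m. (\<forall>y\<in>J. \<forall>z\<in>J. \<bar>y - z\<bar> < \<delta>) \<longrightarrow>
     real (card {j\<in>{..<m}. (T ^^ j) x \<in> J}) \<le> real m / real (Suc n) + 1"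
proof -
  obtain \<delta> where \<delta>: "0 < \<delta>"
    "\<forall>x\<in>{0..<1}. \<forall>j. 0 < j \<and> j \<le> n \<longrightarrow> \<delta> \<le> \<bar>(T ^^ j) x - x\<bar>"
    using return_gap[of n] by (elim exE conjE)
  have "real (card {j\<in>{..<m}. (T ^^ j) x \<in> J}) \<le> real m / real (Suc n) + 1"
    if x: "x \<in> {0..<1}" and J: "\<And>y z. y \<in> J \<Longrightarrow> z \<in> J \<Longrightarrow> \<bar>y - z\<bar> < \<delta>" for x J m
  proof -
    have "card {j\<in>{..<m}. (T ^^ j) x \<in> J} \<le> m div Suc n + 1"
    proof (rule card_separated)
      fix i j assume ij: "i \<in> {j\<in>{..<m}. (T ^^ j) x \<in> J}" "j \<in> {j\<in>{..<m}. (T ^^ j) x \<in> J}" "i < j"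
      have "(T ^^ j) x = (T ^^ (j - i)) ((T ^^ i) x)"
        using ij(3) by (simp flip: comp_apply[of "_ ^^ _"] add: funpow_add[symmetric])
      moreover have "\<bar>(T ^^ j) x - (T ^^ i) x\<bar> < \<delta>" using ij J by blast
      moreover have "0 < j - i" using ij(3) by simp
      ultimately show "Suc n \<le> j - i"
        using bspec[OF \<delta>(2) T_funpow_in[OF x, of i]] by (metis not_less not_less_eq_eq)
    qed auto
    then have "real (card {j\<in>{..<m}. (T ^^ j) x \<in> J}) \<le> real (m div Suc n) + 1" by linarith
    also have "real (m div Suc n) \<le> real m / real (Suc n)" by (rule of_nat_div_le_of_nat)
    finally show ?thesis by simp
  qed
  then have "\<forall>x\<in>{0..<1}. \<forall>J m. (\<forall>y\<in>J. \<forall>z\<in>J. \<bar>y - z\<bar> < \<delta>) \<longrightarrow>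
     real (card {j\<in>{..<m}. (T ^^ j) x \<in> J}) \<le> real m / real (Suc n) + 1"
    by (intro ballI allI impI) simp
  with \<delta>(1) show ?thesis by (intro exI[of _ \<delta>] conjI)
qed

end

section \<open>Empirical measures of long orbit segments\<close>

locale orbit_segments = itm_aperiodic +
  fixes x :: "nat \<Rightarrow> real" and m :: "nat \<Rightarrow> nat"
  assumes start: "x i \<in> {0..<1}" and m_pos: "0 < m i"
    and m_tendsto: "filterlim (\<lambda>i. real (m i)) at_top sequentially"
begin

definition emp :: "nat \<Rightarrow> real measure" where
  "emp i = distr (measure_pmf (pmf_of_set {..<m i})) borel (\<lambda>j. (T ^^ j) (x i))"

lemma emp_distribution: "real_distribution (emp i)"
proof -
  have "prob_space (emp i)"
    unfolding emp_def by (rule prob_space.prob_space_distr) (auto simp: measure_pmf.prob_space_axioms)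
  then show ?thesis
    by (intro real_distribution.intro real_distribution_axioms.intro) (auto simp: emp_def)
qed

lemma measure_emp_card:
  assumes "A \<in> sets borel"
  shows "measure (emp i) A = card {j\<in>{..<m i}. (T ^^ j) (x i) \<in> A} / m i"
proof -
  have "measure (emp i) A = measure (measure_pmf (pmf_of_set {..<m i})) ((\<lambda>j. (T ^^ j) (x i)) -` A)"
    unfolding emp_def using assms by (subst measure_distr) auto
  also have "\<dots> = card ({..<m i} \<inter> (\<lambda>j. (T ^^ j) (x i)) -` A) / m i"
    using m_pos[of i] by (subst measure_pmf_of_set) auto
  also have "{..<m i} \<inter> (\<lambda>j. (T ^^ j) (x i)) -` A = {j\<in>{..<m i}. (T ^^ j) (x i) \<in> A}" by auto
  finally show ?thesis .
qed

lemma measure_emp_sum: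
  assumes "A \<in> sets borel"
  shows "measure (emp i) A = (\<Sum>j<m i. indicator A ((T ^^ j) (x i))) / m i"
  unfolding measure_emp_card[OF assms]
  by (simp add: indicator_def of_bool_def sum.If_cases Int_def)

lemma inverse_m_tendsto: "(\<lambda>i. c / real (m i)) \<longlonglongrightarrow> 0"
  using m_tendsto by (rule real_tendsto_divide_at_top[OF tendsto_const])

lemma emp_tight: "tight emp"
  unfolding tight_def
proof (intro conjI allI impI)
  fix \<epsilon> :: real assume "0 < \<epsilon>"
  have "measure (emp i) {-1<..1} = 1" for i
  proof -
    have "(T ^^ j) (x i) \<in> {-1<..1}" for j
      using T_funpow_in[OF start[of i], of j] by auto
    then have "{j \<in> {..<m i}. (T ^^ j) (x i) \<in> {-1<..1}} = {..<m i}"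
      by blast
    then show ?thesis using m_pos[of i] by (simp add: measure_emp_card)
  qed
  then show "\<exists>a b. a < b \<and> (\<forall>i. 1 - \<epsilon> < measure (emp i) {a<..b})"
    using \<open>0 < \<epsilon>\<close> by (intro exI[of _ "-1"] exI[of _ 1]) auto
qed (rule emp_distribution)

end

section \<open>Their weak limits\<close>

locale limit_measure = orbit_segments +
  fixes M :: "real measure"
  assumes M_distribution: "real_distribution M" and M_limit: "weak_conv_m emp M"
begin

sublocale M: real_distribution M
  by (rule M_distribution)

lemma measure_tendsto_null:
  assumes "A \<in> sets borel" "emeasure M (frontier A) = 0"
  shows "(\<lambda>i. measure (emp i) A) \<longlonglongrightarrow> measure M A"
  using weak_conv_imp_continuity_set_conv[OF emp_distribution M_distribution M_limit assms] .

text \<open>A short interval around \<open>y\<close> carries empirical mass at most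
  \<open>1 / (n + 1)\<close> plus a vanishing error, for every \<open>n\<close>.\<close>

lemma no_atom: "measure M {y} = 0"
proof -
  have "measure M {y} \<le> 1 / real (Suc n)" for n
  proof -
    obtain \<delta> where \<delta>: "0 < \<delta>" "\<forall>x\<in>{0..<1}. \<forall>J m. (\<forall>y\<in>J. \<forall>z\<in>J. \<bar>y - z\<bar> < \<delta>) \<longrightarrow>
     real (card {j\<in>{..<m}. (T ^^ j) x \<in> J}) \<le> real m / real (Suc n) + 1"
      using sparse_visits[of n] by (elim exE conjE)
    \<comment> \<open>Only countably many points are atoms. Endpoints avoiding them make the
      interval a continuity set, before atomlessness is known.\<close>
    obtain a where a: "a \<in> {y - \<delta> / 2<..<y}" "a \<notin> {x. measure M {x} > 0}"
      using real_interval_avoid_countable_set[OF _ M.countable_atoms, of "y - \<delta> / 2" y] \<delta>(1) by auto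
    obtain b where b: "b \<in> {y<..<y + \<delta> / 2}" "b \<notin> {x. measure M {x} > 0}"
      using real_interval_avoid_countable_set[OF _ M.countable_atoms, of y "y + \<delta> / 2"] \<delta>(1) by auto
    have "emeasure M {a, b} = 0"
    proof -
      have "emeasure M {a} = 0" "emeasure M {b} = 0"
        using a(2) b(2) by (auto simp: M.emeasure_eq_measure zero_less_measure_iff)
      then have "{a} \<in> null_sets M" "{b} \<in> null_sets M" by auto
      then have "{a} \<union> {b} \<in> null_sets M" by (rule null_sets.Un)
      then show ?thesis by (simp add: null_sets_def insert_commute)
    qed
    moreover have "frontier {a<..<b} \<subseteq> {a, b}"
      unfolding greaterThanLessThan_def using frontier_Int_subset[of "{a<..}" "{..<b}"] by auto
    ultimately have "emeasure M (frontier {a<..<b}) = 0"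
      by (metis M.sets_M borel_closed closed_insert closed_singleton emeasure_mono le_zero_eq)
    then have lim: "(\<lambda>i. measure (emp i) {a<..<b}) \<longlonglongrightarrow> measure M {a<..<b}"
      by (intro measure_tendsto_null) auto
    have bound: "measure (emp i) {a<..<b} \<le> 1 / real (Suc n) + 1 / real (m i)" for i
    proof -
      have "\<forall>u\<in>{a<..<b}. \<forall>v\<in>{a<..<b}. \<bar>u - v\<bar> < \<delta>" using a(1) b(1) by auto
      then have "real (card {j\<in>{..<m i}. (T ^^ j) (x i) \<in> {a<..<b}}) \<le> real (m i) / real (Suc n) + 1"
        using bspec[OF \<delta>(2) start[of i]] by blast
      then have "real (card {j\<in>{..<m i}. (T ^^ j) (x i) \<in> {a<..<b}}) / m i
          \<le> (real (m i) / real (Suc n) + 1) / m i"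
        by (intro divide_right_mono) auto
      also have "\<dots> = 1 / real (Suc n) + 1 / real (m i)"
        using m_pos[of i] by (simp add: add_divide_distrib)
      finally show ?thesis by (simp add: measure_emp_card)
    qed
    have "(\<lambda>i. 1 / real (Suc n) + 1 / real (m i)) \<longlonglongrightarrow> 1 / real (Suc n) + 0"
      by (intro tendsto_add tendsto_const inverse_m_tendsto)
    then have "measure M {a<..<b} \<le> 1 / real (Suc n) + 0"
      using LIMSEQ_le[OF lim] bound by blast
    moreover have "measure M {y} \<le> measure M {a<..<b}"
      using a(1) b(1) by (intro M.finite_measure_mono) auto
    ultimately show ?thesis by simp
  qed
  moreover have "(\<lambda>n. 1 / real (Suc n)) \<longlonglongrightarrow> 0"
    using LIMSEQ_inverse_real_of_nat by (simp add: inverse_eq_divide)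
  ultimately have "measure M {y} \<le> 0"
    by (intro LIMSEQ_le_const[of "\<lambda>n. 1 / real (Suc n)"]) auto
  then show ?thesis using measure_nonneg[of M "{y}"] by linarith
qed

lemma measure_tendsto:
  assumes "finite (frontier A)"
  shows "(\<lambda>i. measure (emp i) A) \<longlonglongrightarrow> measure M A"
proof (rule measure_tendsto_null)
  show "A \<in> sets borel" using finite_frontier_borel[OF assms] .
  have "measure M (frontier A) = 0"
    using M.finite_measure_eq_sum_singleton[OF assms] no_atom by simp
  then show "emeasure M (frontier A) = 0" by (simp add: M.emeasure_eq_measure)
qed

text \<open>The map is discontinuous, so invariance of the limit is not automatic. Preimages of
  half-lines have finite frontier, however, and \<open>measure_tendsto\<close> applies to
  them.\<close>

lemma M_invariant: "distr M borel T = M"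
proof (rule cdf_unique')
  have T: "T \<in> measurable M borel" by simp
  show "finite_borel_measure (distr M borel T)"
    by (intro finite_borel_measure.intro finite_borel_measure_axioms.intro M.finite_measure_distr T) simp
  show "finite_borel_measure M" by (rule M.finite_borel_measure_M)
  show "cdf (distr M borel T) = cdf M"
  proof
    fix t :: real
    let ?A = "{..t}"
    have [measurable]: "T -` ?A \<in> sets borel"
      using measurable_sets[OF itm_measurable, of ?A] by simp
    have "(\<lambda>i. measure (emp i) (T -` ?A) - measure (emp i) ?A) \<longlonglongrightarrow> measure M (T -` ?A) - measure M ?A"
      by (intro tendsto_diff measure_tendsto finite_frontier_vimage) auto
    moreover have "(\<lambda>i. measure (emp i) (T -` ?A) - measure (emp i) ?A) \<longlonglongrightarrow> 0"
    proof (rule Lim_null_comparison[OF _ inverse_m_tendsto[of 1]], rule always_eventually, rule allI)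
      fix i
      \<comment> \<open>Passing to the preimage shifts the segment by one step, so only its two ends
        contribute.\<close>
      have "(\<Sum>j<m i. indicator (T -` ?A) ((T ^^ j) (x i)) :: real)
          - (\<Sum>j<m i. indicator ?A ((T ^^ j) (x i)))
          = (\<Sum>j<m i. indicator ?A ((T ^^ Suc j) (x i)) - indicator ?A ((T ^^ j) (x i)))"
        by (simp add: sum_subtractf indicator_vimage[symmetric] indicator_def)
      also have "\<dots> = indicator ?A ((T ^^ m i) (x i)) - indicator ?A (x i)"
        by (subst sum_lessThan_telescope) simp
      finally have "measure (emp i) (T -` ?A) - measure (emp i) ?A
          = (indicator ?A ((T ^^ m i) (x i)) - indicator ?A (x i)) / m i"
        by (simp add: measure_emp_sum diff_divide_distrib[symmetric])
      then show "norm (measure (emp i) (T -` ?A) - measure (emp i) ?A) \<le> 1 / real (m i)"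
        by (auto simp: indicator_def)
    qed
    ultimately have "measure M (T -` ?A) = measure M ?A"
      using LIMSEQ_unique by fastforce
    then show "cdf (distr M borel T) t = cdf M t"
      unfolding cdf_def by (subst measure_distr) (auto simp: T)
  qed
qed

text \<open>All but the first \<open>n\<close> points of a segment lie in
  \<open>Omega_n \<alpha> \<beta> n\<close>.\<close>

lemma measure_Omega_n: "measure M (Omega_n \<alpha> \<beta> n) = 1"
proof -
  have borel: "Omega_n \<alpha> \<beta> n \<in> sets borel"
    using Omega_n_regular finite_frontier_borel by blast
  have "1 - real n / real (m i) \<le> measure (emp i) (Omega_n \<alpha> \<beta> n)" for i
  proof -
    have "{n..<m i} \<subseteq> {j\<in>{..<m i}. (T ^^ j) (x i) \<in> Omega_n \<alpha> \<beta> n}"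
    proof
      fix j assume j: "j \<in> {n..<m i}"
      have "(T ^^ j) (x i) \<in> Omega_n \<alpha> \<beta> j" using start[of i] unfolding Omega_n_eq by blast
      then show "j \<in> {j\<in>{..<m i}. (T ^^ j) (x i) \<in> Omega_n \<alpha> \<beta> n}"
        using Omega_n_mono[of n j] j by auto
    qed
    then have "card {n..<m i} \<le> card {j\<in>{..<m i}. (T ^^ j) (x i) \<in> Omega_n \<alpha> \<beta> n}"
      by (intro card_mono) auto
    then have "real (m i) - real n \<le> card {j\<in>{..<m i}. (T ^^ j) (x i) \<in> Omega_n \<alpha> \<beta> n}"
      by simp
    then have "(real (m i) - real n) / m i \<le> measure (emp i) (Omega_n \<alpha> \<beta> n)"
      unfolding measure_emp_card[OF borel] by (intro divide_right_mono) auto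
    then show ?thesis using m_pos[of i] by (simp add: diff_divide_distrib)
  qed
  moreover have "(\<lambda>i. 1 - real n / real (m i)) \<longlonglongrightarrow> 1 - 0"
    by (intro tendsto_diff tendsto_const inverse_m_tendsto)
  moreover have "(\<lambda>i. measure (emp i) (Omega_n \<alpha> \<beta> n)) \<longlonglongrightarrow> measure M (Omega_n \<alpha> \<beta> n)"
    using Omega_n_regular measure_tendsto by blast
  ultimately have "1 - 0 \<le> measure M (Omega_n \<alpha> \<beta> n)"
    by (intro LIMSEQ_le[of "\<lambda>i. 1 - real n / real (m i)" _ "\<lambda>i. measure (emp i) (Omega_n \<alpha> \<beta> n)"])
      auto
  then show ?thesis using M.prob_le_1[of "Omega_n \<alpha> \<beta> n"] by linarith
qed

lemma AE_Omega: "AE y in M. y \<in> Omega \<alpha> \<beta>"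
proof -
  have "AE y in M. y \<in> Omega_n \<alpha> \<beta> n" for n
    using measure_Omega_n[of n] M.prob_eq_1[of "Omega_n \<alpha> \<beta> n"]
      Omega_n_regular[of n] finite_frontier_borel by auto
  then show ?thesis unfolding Omega_def by (simp add: AE_all_countable)
qed

abbreviation "M_restr \<equiv> restrict_space M (closure (Omega \<alpha> \<beta>))"

lemma AE_closure: "AE y in M. y \<in> closure (Omega \<alpha> \<beta>)"
  using AE_Omega closure_subset by (auto elim!: AE_mp)

lemma emeasure_M_restr:
  "A \<subseteq> closure (Omega \<alpha> \<beta>) \<Longrightarrow> emeasure M_restr A = emeasure M A"
  by (rule emeasure_restrict_space) auto

text \<open>Almost every point lies in \<open>Omega \<alpha> \<beta>\<close>, where
  \<open>itm_closure\<close> agrees with \<open>itm\<close>; invariance is inherited from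
  \<open>M\<close>.\<close>

lemma invariant_borel_prob_M_restr:
  "invariant_borel_prob (closure (Omega \<alpha> \<beta>)) (itm_closure \<alpha> \<beta>) M_restr"
  unfolding invariant_borel_prob_def
proof (intro conjI)
  let ?C = "closure (Omega \<alpha> \<beta>)" and ?f = "itm_closure \<alpha> \<beta>"
  show "sets M_restr = sets (restrict_space borel ?C)"
    by (rule sets_restrict_space_cong) simp
  have C: "?C \<in> sets borel" by simp
  have "measure M ?C = 1"
    using M.prob_eq_1[of ?C] AE_closure C by auto
  then show "prob_space M_restr"
    using C by (intro prob_space_restrict_space) (auto simp: M.emeasure_eq_measure)
  have fM: "?f \<in> measurable M M"
    using itm_closure_measurable by (simp add: measurable_def M.borel_UNIV)
  show f: "?f \<in> measurable M_restr M_restr"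
    by (rule measurable_restrict_space3[OF fM]) (use itm_closure_in in auto)
  show "distr M_restr M_restr ?f = M_restr"
  proof (rule measure_eqI)
    fix A assume "A \<in> sets (distr M_restr M_restr ?f)"
    then have A: "A \<subseteq> ?C" "A \<in> sets borel" by (auto simp: sets_restrict_space_iff)
    have "emeasure (distr M_restr M_restr ?f) A = emeasure M_restr (?f -` A \<inter> space M_restr)"
      using A by (intro emeasure_distr f) (auto simp: sets_restrict_space_iff)
    also have "\<dots> = emeasure M (?f -` A \<inter> ?C)"
      by (subst emeasure_M_restr) (auto simp: space_restrict_space)
    also have "\<dots> = emeasure M (T -` A)"
    proof (rule emeasure_eq_AE)
      show "AE y in M. (y \<in> ?f -` A \<inter> ?C) = (y \<in> T -` A)"
        using AE_Omega AE_closure by eventually_elim (simp add: itm_closure_eq)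
      show "?f -` A \<inter> ?C \<in> sets M"
        using measurable_sets[OF itm_closure_measurable A(2)] C by auto
      show "T -` A \<in> sets M"
        using measurable_sets[OF itm_measurable A(2)] by simp
    qed
    also have "\<dots> = emeasure (distr M borel T) A"
      using A by (subst emeasure_distr) auto
    also have "\<dots> = emeasure M A" by (simp only: M_invariant)
    also have "\<dots> = emeasure M_restr A" using A emeasure_M_restr by simp
    finally show "emeasure (distr M_restr M_restr ?f) A = emeasure M_restr A" .
  qed simp
qed

text \<open>The limit is written through the restricted measure alone, so different limits force
  different invariant measures.\<close>

lemma averages_tendsto:
  "(\<lambda>i. (\<Sum>j<m i. cellval \<alpha> \<beta> (p, q, r) ((T ^^ j) (x i))) / m i) \<longlonglongrightarrow>
     r + (p - q) * measure M_restr ({..<1 - \<alpha>} \<inter> closure (Omega \<alpha> \<beta>))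
       + (q - r) * measure M_restr ({..<1 - \<beta>} \<inter> closure (Omega \<alpha> \<beta>))"
proof -
  have meas: "measure M_restr ({..<t} \<inter> closure (Omega \<alpha> \<beta>)) = measure M {..<t}" for t
  proof -
    have "emeasure M ({..<t} \<inter> closure (Omega \<alpha> \<beta>)) = emeasure M {..<t}"
      by (rule emeasure_eq_AE) (use AE_closure in auto)
    then show ?thesis
      using emeasure_M_restr[of "{..<t} \<inter> closure (Omega \<alpha> \<beta>)"] by (simp add: measure_def)
  qed
  have cell: "cellval \<alpha> \<beta> (p, q, r) z = r + (p - q) * indicator {..<1 - \<alpha>} z + (q - r) * indicator {..<1 - \<beta>} z" for z
    using beta_less by (simp add: cellval_def indicator_def)
  have "(\<Sum>j<m i. cellval \<alpha> \<beta> (p, q, r) ((T ^^ j) (x i))) / m i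
      = r + (p - q) * measure (emp i) {..<1 - \<alpha>} + (q - r) * measure (emp i) {..<1 - \<beta>}" for i
    using m_pos[of i]
    by (simp add: cell sum.distrib sum_distrib_left[symmetric] measure_emp_sum add_divide_distrib)
  then show ?thesis
    unfolding meas by (simp only:) (intro tendsto_intros measure_tendsto; simp)
qed

end

section \<open>Convergent subsequences and the two invariant measures\<close>

lemma (in orbit_segments) exists_invariant_limit:
  "\<exists>N s. strict_mono s \<and> invariant_borel_prob (closure (Omega \<alpha> \<beta>)) (itm_closure \<alpha> \<beta>) N \<and>
    (\<forall>p q r. (\<lambda>i. (\<Sum>j<m (s i). cellval \<alpha> \<beta> (p, q, r) ((T ^^ j) (x (s i)))) / m (s i)) \<longlonglongrightarrow>
     r + (p - q) * measure N ({..<1 - \<alpha>} \<inter> closure (Omega \<alpha> \<beta>))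
       + (q - r) * measure N ({..<1 - \<beta>} \<inter> closure (Omega \<alpha> \<beta>)))"
proof -
  obtain s M where s: "strict_mono (s :: nat \<Rightarrow> nat)" and M: "real_distribution M" "weak_conv_m (emp \<circ> id \<circ> s) M"
    using tight_imp_convergent_subsubsequence[OF emp_tight strict_mono_id] by blast
  \<comment> \<open>A subsequence of segments is again such a family, so everything about limits
    applies to it.\<close>
  interpret sub: orbit_segments \<alpha> \<beta> "x \<circ> s" "m \<circ> s"
  proof
    show "filterlim (\<lambda>i. real ((m \<circ> s) i)) at_top sequentially"
      using filterlim_compose[OF m_tendsto filterlim_subseq[OF s]] by simp
  qed (use start m_pos in auto)
  have "sub.emp = emp \<circ> id \<circ> s" by (auto simp: sub.emp_def emp_def)
  then interpret sub: limit_measure \<alpha> \<beta> "x \<circ> s" "m \<circ> s" M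
    using M by (intro limit_measure.intro limit_measure_axioms.intro sub.orbit_segments_axioms) simp_all
  show ?thesis
    using s sub.invariant_borel_prob_M_restr sub.averages_tendsto by (intro exI conjI allI) simp_all
qed

theorem theorem11:
  fixes \<alpha> \<beta> lam :: real
  assumes "(\<alpha>, \<beta>) \<in> interior U"
    and "type_infinity \<alpha> \<beta>"
    and "lam > 1"
    and "\<forall>\<^sub>F i in sequentially.
           real_of_int (assoc_seq \<alpha> \<beta> (Suc i)) \<ge> lam * real_of_int (assoc_seq \<alpha> \<beta> i)"
  shows "\<not> uniquely_ergodic (closure (Omega \<alpha> \<beta>)) (itm_closure \<alpha> \<beta>)"
proof
  assume unique: "uniquely_ergodic (closure (Omega \<alpha> \<beta>)) (itm_closure \<alpha> \<beta>)"
  define a where "a n = fst ((G ^^ n) (\<alpha>, \<beta>))" for n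
  define b where "b n = snd ((G ^^ n) (\<alpha>, \<beta>))" for n
  have ab0: "a 0 = \<alpha>" "b 0 = \<beta>" by (simp_all add: a_def b_def)
  have ab_Suc: "a (Suc n) = b n / a n" "b (Suc n) = (b n - 1) / a n + of_int \<lfloor>1 / a n\<rfloor>" for n
    by (simp_all add: a_def b_def G_def split: prod.split)
  have "itm_interior \<alpha> \<beta>"
  proof -
    obtain e where e: "0 < e" "ball (\<alpha>, \<beta>) e \<subseteq> U"
      using assms(1) unfolding mem_interior by blast
    \<comment> \<open>Membership of these points in \<open>U\<close> yields
      \<open>0 < \<beta>\<close>, \<open>\<beta> < \<alpha>\<close> and \<open>\<alpha> < 1\<close>
      respectively.\<close>
    have "(\<alpha>, \<beta> - e / 2) \<in> ball (\<alpha>, \<beta>) e" "(\<alpha>, \<beta> + e / 2) \<in> ball (\<alpha>, \<beta>) e"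
      "(\<alpha> + e / 2, \<beta>) \<in> ball (\<alpha>, \<beta>) e"
      using e(1) by (auto simp: dist_Pair_Pair dist_real_def)
    then have "(\<alpha>, \<beta> - e / 2) \<in> U" "(\<alpha>, \<beta> + e / 2) \<in> U" "(\<alpha> + e / 2, \<beta>) \<in> U"
      using e(2) by auto
    then show ?thesis using e(1) by unfold_locales (auto simp: U_def)
  qed
  then have "itm_interior (a n) (b n) \<and> \<not> finite_type (a n) (b n)" for n
  proof (induction n)
    case 0
    then show ?case using finite_type_not_infinity assms(2) ab0 by auto
  next
    case (Suc n)
    then show ?case using itm_interior.interior_renorm[of "a n" "b n"] by (simp add: ab_Suc)
  qed
  then interpret renorm_seq a b
    by (intro renorm_seq.intro) (auto simp: ab_Suc)
  have K: "real_of_int (assoc_seq \<alpha> \<beta> n) = K n" for n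
    using K_ge[of n] unfolding K_def assoc_seq_def a_def[symmetric] by simp
  have growth: "\<forall>\<^sub>F n in sequentially. lam * K n \<le> K (Suc n)"
    using assms(4) unfolding K .
  obtain N where N: "\<And>n. N \<le> n \<Longrightarrow> 2 \<le> K n"
    using K_eventually_ge_2[OF assms(3) growth] by blast
  interpret itm_aperiodic \<alpha> \<beta>
    by unfold_locales
      (use interior[of 0] aperiodic[OF N] in \<open>auto simp: ab0 itm_interior_def\<close>)
  obtain v x m where x: "\<And>i. x i \<in> {0..<1}" and m: "\<And>i. real i / 2 \<le> real (m i)" "\<And>i. 0 < m i"
    and avg: "\<And>i. 1 / 2 \<le> (-1) ^ i * ((\<Sum>j<m i. cellval \<alpha> \<beta> v ((T ^^ j) (x i))) / m i)"
    using oscillating_averages[OF assms(3) growth] unfolding ab0 by blast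
  obtain p q r where v: "v = (p, q, r)" by (cases v)
  have m_lim: "filterlim (\<lambda>i. real (m (s i))) at_top sequentially" if "\<And>i. i \<le> s i" for s :: "nat \<Rightarrow> nat"
  proof (rule filterlim_at_top_mono[of "\<lambda>i. real i / 2"])
    show "filterlim (\<lambda>i. real i / 2) at_top sequentially"
      by real_asymp
    have "real i / 2 \<le> real (m (s i))" for i
      using m(1)[of "s i"] that[of i] by linarith
    then show "\<forall>\<^sub>F i in sequentially. real i / 2 \<le> real (m (s i))" by simp
  qed
  interpret even: orbit_segments \<alpha> \<beta> "\<lambda>i. x (2 * i)" "\<lambda>i. m (2 * i)"
    by unfold_locales (use x m m_lim in auto)
  interpret odd: orbit_segments \<alpha> \<beta> "\<lambda>i. x (2 * i + 1)" "\<lambda>i. m (2 * i + 1)"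
    by unfold_locales (use x m m_lim in auto)
  \<comment> \<open>The integral of the step function \<open>v\<close>, as a function of the
    invariant measure; its values on the two limits will differ in sign.\<close>
  define val where "val N = r + (p - q) * measure N ({..<1 - \<alpha>} \<inter> closure (Omega \<alpha> \<beta>))
       + (q - r) * measure N ({..<1 - \<beta>} \<inter> closure (Omega \<alpha> \<beta>))" for N
  obtain N1 s1 where N1: "invariant_borel_prob (closure (Omega \<alpha> \<beta>)) (itm_closure \<alpha> \<beta>) N1"
    "(\<lambda>i. (\<Sum>j<m (2 * s1 i). cellval \<alpha> \<beta> v ((T ^^ j) (x (2 * s1 i)))) / m (2 * s1 i)) \<longlonglongrightarrow> val N1"
    using even.exists_invariant_limit unfolding val_def v by blast
  obtain N2 s2 where N2: "invariant_borel_prob (closure (Omega \<alpha> \<beta>)) (itm_closure \<alpha> \<beta>) N2"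
    "(\<lambda>i. (\<Sum>j<m (2 * s2 i + 1). cellval \<alpha> \<beta> v ((T ^^ j) (x (2 * s2 i + 1)))) / m (2 * s2 i + 1)) \<longlonglongrightarrow> val N2"
    using odd.exists_invariant_limit unfolding val_def v by blast
  have "1 / 2 \<le> val N1"
    by (rule LIMSEQ_le_const[OF N1(2)]) (use avg[of "2 * s1 _"] in auto)
  moreover have "val N2 \<le> - 1 / 2"
  proof (rule LIMSEQ_le_const2[OF N2(2)], intro exI allI impI)
    fix i
    have "(-1 :: real) ^ (2 * s2 i + 1) = -1" by simp
    then show "(\<Sum>j<m (2 * s2 i + 1). cellval \<alpha> \<beta> v ((T ^^ j) (x (2 * s2 i + 1)))) / m (2 * s2 i + 1) \<le> - 1 / 2"
      using avg[of "2 * s2 i + 1"] by (simp only: minus_mult_left[symmetric] mult_1_left)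
  qed
  moreover have "N1 = N2"
    using unique N1(1) N2(1) unfolding uniquely_ergodic_def by blast
  ultimately show False by simp
qed

end
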